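(* Let $n \geq 2$ and let $K \subset \mathbb{R}^n$ be a compact set with positive logarithmic capacity, $C_{\log}(K)>0$. Let $M$ be a real $n \times n$ volume-preserving matrix (that is, $\det M = \pm 1$), and suppose $K$ has an irreducible group of isometries. Then \[ C_{\log}(MK) \geq C_{\log}(K), \] with equality if and only if $M$ is orthogonal. In particular, if a compact set $K \subset \mathbb{R}^n$ has an irreducible isometry group and positive volume, then it minimizes logarithmic capacity among all its linear images of the same volume.
   Context: The logarithmic energy of a compact set $K \subset \mathbb{R}^n$, $n \ge 2$, is \[ V_{\log}(K) = \min_\mu \int_K \int_K \log \frac{1}{|x-y|} \, d\mu(x)\, d\mu(y) \in (-\infty,+\infty], \] where the minimum is over all Borel probability measures $\mu$ on $K$ (the minimum is attained). The logarithmic capacity is $C_{\log}(K) = \exp(-V_{\log}(K)) \in [0,\infty)$, with value $0$ when $V_{\log}(K)=+\infty$. An isometry of a set $K \subset \mathbb{R}^n$ is an orthogonal $n \times n$ matrix $U$ with $UK=K$. A group $\mathcal{U}$ of orthogonal $n\times n$ matrices is irreducible if the only subspaces of $\mathbb{R}^n$ invariant under the action of the group are $\{0\}$ and $\mathbb{R}^n$; equivalently, $\{Ux : U \in \mathcal{U}\}$ spans $\mathbb{R}^n$ for every nonzero $x \in \mathbb{R}^n$. Volume means $n$-dimensional Lebesgue measure, and $MK=\{Mx : x\in K\}$. *)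

theory Defs
  imports "HOL-Analysis.Analysis" "HOL-Probability.Probability_Measure"
begin

text \<open>
  The kernel \<open>log (1 / |x - y|)\<close>, with the value \<open>+\<infinity>\<close> on the diagonal. The diagonal is a
  separate case because \<open>ln (1 / 0) = 0\<close> in HOL.
\<close>

definition log_kernel :: "'a::real_normed_vector \<Rightarrow> 'a \<Rightarrow> ereal" where
  "log_kernel x y = (if x = y then \<infinity> else ereal (ln (1 / norm (x - y))))"

text \<open>
  Lebesgue integral with values in \<open>[-\<infinity>, +\<infinity>]\<close>: the integral of the positive part minus that of
  the negative part (\<open>e2ennreal\<close> truncates negative values to \<open>0\<close>). The Bochner integral is
  not usable here, as it returns \<open>0\<close> on functions whose integral is \<open>+\<infinity>\<close>. Below, the
  negative part is always bounded, so \<open>\<infinity> - \<infinity>\<close> does not arise.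
\<close>

definition extended_integral :: "'a measure \<Rightarrow> ('a \<Rightarrow> ereal) \<Rightarrow> ereal" where
  "extended_integral \<mu> f =
     enn2ereal (\<integral>\<^sup>+ x. e2ennreal (f x) \<partial>\<mu>) - enn2ereal (\<integral>\<^sup>+ x. e2ennreal (- f x) \<partial>\<mu>)"

definition borel_prob_measures_on :: "'a::topological_space set \<Rightarrow> 'a measure set" where
  "borel_prob_measures_on K = {\<mu>. prob_space \<mu> \<and> sets \<mu> = sets (restrict_space borel K)}"

text \<open>
  The minimum over all measures is written as an infimum; for nonempty compact \<open>K\<close> in Euclidean
  space it is attained. For \<open>K = {}\<close> there are no measures and the energy is \<open>+\<infinity>\<close>.
\<close>

definition log_energy :: "'a::real_normed_vector set \<Rightarrow> ereal" where
  "log_energy K =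
     (INF \<mu> \<in> borel_prob_measures_on K.
        extended_integral \<mu> (\<lambda>y. extended_integral \<mu> (\<lambda>x. log_kernel x y)))"

text \<open>The energy of a compact set is never \<open>-\<infinity>\<close>, so only \<open>+\<infinity>\<close> needs a separate case.\<close>

definition log_capacity :: "'a::real_normed_vector set \<Rightarrow> real" where
  "log_capacity K =
     (if log_energy K = \<infinity> then 0 else exp (- real_of_ereal (log_energy K)))"

definition linear_image :: "real^'n^'n \<Rightarrow> (real^'n) set \<Rightarrow> (real^'n) set" where
  "linear_image M K = (\<lambda>x. M *v x) ` K"

definition isometry_of :: "real^'n^'n \<Rightarrow> (real^'n) set \<Rightarrow> bool" where
  "isometry_of U K \<longleftrightarrow> orthogonal_matrix U \<and> linear_image U K = K"

definition orthogonal_matrix_group :: "(real^'n^'n) set \<Rightarrow> bool" where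
  "orthogonal_matrix_group G \<longleftrightarrow>
     (\<forall>U\<in>G. orthogonal_matrix U) \<and> mat 1 \<in> G \<and>
     (\<forall>U\<in>G. \<forall>V\<in>G. U ** V \<in> G) \<and> (\<forall>U\<in>G. matrix_inv U \<in> G)"

definition irreducible_matrix_group :: "(real^'n^'n) set \<Rightarrow> bool" where
  "irreducible_matrix_group G \<longleftrightarrow>
     (\<forall>S. subspace S \<and> (\<forall>U\<in>G. linear_image U S \<subseteq> S) \<longrightarrow> S = {0} \<or> S = UNIV)"

definition has_irreducible_isometry_group :: "(real^'n) set \<Rightarrow> bool" where
  "has_irreducible_isometry_group K \<longleftrightarrow>
     (\<exists>G. orthogonal_matrix_group G \<and> (\<forall>U\<in>G. isometry_of U K) \<and> irreducible_matrix_group G)"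

end

theory Submission
  imports Defs "HOL-Probability.Distributions" "HOL-Probability.Probability_Mass_Function"
begin

text \<open>
  Write \<open>M\<^sup>T M = P diag(d) P\<^sup>T\<close> with \<open>P\<close> orthogonal and \<open>\<Prod>d = 1\<close>, and let \<open>L = P diag(ln d / 2) P\<^sup>T\<close>.
  Concavity of the logarithm gives \<open>ln (|Mz| / |z|) \<ge> (z \<bullet> L z) / |z|\<^sup>2\<close>, with a quadratic remainder that vanishes
  only if \<open>z\<close> is an eigenvector of \<open>M\<^sup>T M\<close>. As \<open>L\<close> has trace 0, irreducibility puts 0 into the closed convex hull of
  the conjugates \<open>W\<^sup>T L W\<close> by isometries \<open>W\<close> of \<open>K\<close>. Hence for each probability measure \<open>\<nu>\<close> on \<open>K\<close> some \<open>W\<close> makes the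
  energy of the push-forward of \<open>\<nu>\<close> under \<open>M W\<close> at most that of \<open>\<nu>\<close> minus the averaged remainder, up to an
  arbitrarily small error.

  For strictness the remainder has to be bounded below uniformly, so that neither the existence nor the uniqueness
  of equilibrium measures is needed. A measure of bounded energy charges two separated small balls. Its average
  over finitely many isometries spanning the same linear space as the whole group has no larger energy, because the
  logarithmic kernel is a mixture of Gaussians and hence conditionally positive definite. This average charges all
  the images of the two balls. The centres of these images cannot have all their pairwise differences in
  eigenspaces of \<open>M\<^sup>T M\<close>: otherwise one eigenspace would contain an orbit, be the whole space, and \<open>M\<close> would be
  orthogonal. Compactness makes this uniform.
\<close>

section \<open>Symmetric matrices and irreducible groups\<close>

text \<open>\<open>G\<close> is an arbitrary group of orthogonal matrices, possibly infinite and not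
  closed, so the least-norm point of the closed hull of the conjugates stands in for a group
  average. The price is that a good \<open>W\<close> exists only up to an error and depends on the
  measure. As \<open>W K = K\<close>, passing from \<open>M\<close> to \<open>M W\<close> does not
  change the image of \<open>K\<close>. The order of choices shapes the rest. The gain must be fixed
  before \<open>W\<close> is known, hence the defect is bounded below over all orthogonal
  \<open>W\<close>, which form a compact set. It must also be fixed before the measure is chosen,
  since the energy is only an infimum. A single pair of balls is not enough: \<open>W\<close> may
  turn the difference of the two centres into an eigenvector of \<open>M\<^sup>T M\<close>, so that
  the remainder vanishes there. The averaging supplies enough further pairs, and it may not raise
  the energy; this is the only purpose of the Gaussian representation. Half of the guaranteed gain
  finally pays for the error in the choice of \<open>W\<close>.\<close>

lemma linear_coeff_zero:
  fixes b c :: real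
  assumes "\<And>t. 2 * t * b + t\<^sup>2 * c \<le> 0" "b \<ge> 0"
  shows "b = 0"
proof (rule ccontr)
  assume "b \<noteq> 0"
  then have b: "b > 0" using assms(2) by simp
  \<comment> \<open>Small enough that t |c| is at most b, so the linear term dominates.\<close>
  define t where "t = b / (\<bar>c\<bar> + 1)"
  have t: "t > 0" using b by (simp add: t_def)
  have "t * \<bar>c\<bar> \<le> t * (\<bar>c\<bar> + 1)" using t by simp
  also have "\<dots> = b" by (simp add: t_def)
  finally have "t * \<bar>c\<bar> \<le> b" .
  moreover have "t * c \<ge> - (t * \<bar>c\<bar>)"
    using t by (metis abs_ge_minus_self abs_mult abs_of_pos minus_le_iff)
  ultimately have "2 * b + t * c > 0" using b by linarith
  then have "t * (2 * b + t * c) > 0" using t by simp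
  then show False using assms(1)[of t] by (simp add: algebra_simps power2_eq_square)
qed

text \<open>The Rayleigh quotient attains its maximum \<open>l\<close> over the unit vectors of
  \<open>S\<close> at some \<open>v\<close>. Along the residual \<open>y = f v - l v\<close>, which
  lies in \<open>S\<close>, the form x . f x - l |x|^2 has first-order coefficient 2 |y|^2 at
  \<open>v\<close>; maximality forces \<open>y = 0\<close>.\<close>

lemma self_adjoint_eigenvector:
  fixes f :: "'a::euclidean_space \<Rightarrow> 'a"
  assumes f: "linear f" and sa: "\<And>x y. f x \<bullet> y = x \<bullet> f y"
    and S: "subspace S" "S \<noteq> {0}" and inv: "\<And>x. x \<in> S \<Longrightarrow> f x \<in> S"
  obtains v l where "v \<in> S" "norm v = 1" "f v = l *\<^sub>R v"
proof -
  interpret f: linear f by fact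
  let ?C = "S \<inter> sphere 0 1"
  obtain x where x: "x \<in> S" "x \<noteq> 0" using S subspace_0 by blast
  have "x /\<^sub>R norm x \<in> ?C" using x S by (auto intro: subspace_scale)
  then have ne: "?C \<noteq> {}" by blast
  have "compact ?C"
    using closed_subspace[OF S(1)] compact_Int_closed[of "sphere 0 1" S] by (simp add: Int_commute)
  moreover have "continuous_on ?C (\<lambda>x. x \<bullet> f x)"
    using f by (intro continuous_intros linear_continuous_on) (simp add: linear_conv_bounded_linear)
  ultimately obtain v where v: "v \<in> ?C" and mx: "\<And>x. x \<in> ?C \<Longrightarrow> x \<bullet> f x \<le> v \<bullet> f v"
    using continuous_attains_sup[OF _ ne] by meson
  define l where "l = v \<bullet> f v"
  have le: "x \<bullet> f x \<le> l * (norm x)\<^sup>2" if "x \<in> S" for x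
  proof (cases "x = 0")
    case False
    have "x /\<^sub>R norm x \<in> ?C" using that False S by (auto intro: subspace_scale)
    from mx[OF this] show ?thesis
      using False by (simp add: f.scale l_def field_simps power2_eq_square)
  qed (simp add: f.zero)
  define y where "y = f v - l *\<^sub>R v"
  have vS: "v \<in> S" and nv: "norm v = 1" using v by auto
  have yS: "y \<in> S" unfolding y_def using vS S inv by (intro subspace_diff subspace_scale) auto
  have "(norm y)\<^sup>2 = 0"
  proof (rule linear_coeff_zero)
    fix t
    have "v + t *\<^sub>R y \<in> S" using vS yS S by (intro subspace_add subspace_scale)
    note 1 = le[OF this]
    have 2: "(v + t *\<^sub>R y) \<bullet> f (v + t *\<^sub>R y) = l + 2 * t * (y \<bullet> f v) + t\<^sup>2 * (y \<bullet> f y)"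
      using sa[of v y]
      by (simp add: f.add f.scale inner_simps l_def power2_eq_square inner_commute algebra_simps)
    have 3: "(norm (v + t *\<^sub>R y))\<^sup>2 = 1 + 2 * t * (y \<bullet> v) + t\<^sup>2 * (norm y)\<^sup>2"
      using nv unfolding power2_norm_eq_inner
      by (simp add: inner_simps norm_eq_1 power2_eq_square inner_commute algebra_simps)
    have "(norm y)\<^sup>2 = y \<bullet> f v - l * (y \<bullet> v)"
      by (simp add: power2_norm_eq_inner y_def inner_simps)
    then have 4: "2 * t * (norm y)\<^sup>2 = 2 * t * (y \<bullet> f v) - l * (2 * t * (y \<bullet> v))"
      by (simp only: right_diff_distrib mult_ac)
    show "2 * t * (norm y)\<^sup>2 + t\<^sup>2 * (y \<bullet> f y - l * (norm y)\<^sup>2) \<le> 0"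
      using 1 unfolding 2 3 4 by (simp add: algebra_simps)
  qed simp
  then have "f v = l *\<^sub>R v" by (simp add: y_def)
  then show thesis using that vS nv by blast
qed

lemma self_adjoint_orthonormal_eigenvectors:
  fixes f :: "'a::euclidean_space \<Rightarrow> 'a"
  assumes f: "linear f" and sa: "\<And>x y. f x \<bullet> y = x \<bullet> f y" and "k \<le> DIM('a)"
  shows "\<exists>B. finite B \<and> card B = k \<and> pairwise orthogonal B \<and> (\<forall>b\<in>B. norm b = 1 \<and> (\<exists>l. f b = l *\<^sub>R b))"
  using \<open>k \<le> DIM('a)\<close>
proof (induction k)
  case 0
  then show ?case by (intro exI[of _ "{}"]) auto
next
  case (Suc k)
  then obtain B where B: "finite B" "card B = k" "pairwise orthogonal B"
    "\<And>b. b \<in> B \<Longrightarrow> norm b = 1 \<and> (\<exists>l. f b = l *\<^sub>R b)" by auto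
  define S where "S = {x. \<forall>b\<in>B. orthogonal x b}"
  have "subspace S" unfolding S_def subspace_def orthogonal_def by (auto simp: inner_simps)
  have "dim (span B) < DIM('a)"
    using dim_le_card'[OF B(1)] B(2) Suc.prems by (simp add: dim_span)
  then obtain x where x: "x \<noteq> 0" "\<And>y. y \<in> span B \<Longrightarrow> orthogonal x y"
    using orthogonal_to_subspace_exists[of "B"] by (auto simp: dim_span)
  have "x \<in> S" using x(2) by (auto simp: S_def span_base)
  then have ne: "S \<noteq> {0}" using x(1) by blast
  \<comment> \<open>By self-adjointness the orthogonal complement of the eigenvectors found so far
    is invariant, so the next one can be sought inside it.\<close>
  have "f y \<in> S" if "y \<in> S" for y
    unfolding S_def
  proof (clarify)
    fix b assume "b \<in> B"
    then obtain l where "f b = l *\<^sub>R b" using B(4) by blast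
    then show "orthogonal (f y) b" using that \<open>b \<in> B\<close> by (simp add: S_def orthogonal_def sa)
  qed
  then obtain v l where v: "v \<in> S" "norm v = 1" "f v = l *\<^sub>R v"
    using self_adjoint_eigenvector[OF f sa \<open>subspace S\<close> ne] by blast
  have "v \<notin> B"
  proof
    assume "v \<in> B"
    then have "orthogonal v v" using v(1) by (auto simp: S_def)
    then show False using v(2) by (simp add: orthogonal_self)
  qed
  moreover have "pairwise orthogonal (insert v B)"
    using B(3) v(1) by (auto simp: pairwise_insert S_def orthogonal_commute)
  ultimately show ?case
    using B v by (intro exI[of _ "insert v B"]) auto
qed

definition diag_matrix :: "('n \<Rightarrow> real) \<Rightarrow> real^'n^'n" where
  "diag_matrix d = (\<chi> i j. if i = j then d i else 0)"

lemma diag_matrix_vector [simp]: "(diag_matrix d *v x) $ i = d i * x $ i" for x :: "real^'n::finite"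
  by (simp add: diag_matrix_def matrix_vector_mult_def if_distrib[of "\<lambda>u. u * _"] cong: if_cong)

lemma symmetric_matrix_inner:
  fixes A :: "real^'n^'n"
  assumes "transpose A = A"
  shows "(A *v x) \<bullet> y = x \<bullet> (A *v y)"
  using dot_lmul_matrix[of x A y] assms by (metis vector_transpose_matrix)

lemma symmetric_matrix_diagonalization:
  fixes A :: "real^'n^'n"
  assumes "transpose A = A"
  obtains P d where "orthogonal_matrix P" "A = P ** diag_matrix d ** transpose P"
proof -
  obtain B where B: "finite B" "card B = CARD('n)" "pairwise orthogonal B"
    "\<And>b. b \<in> B \<Longrightarrow> norm b = 1 \<and> (\<exists>l. A *v b = l *\<^sub>R b)"
    using self_adjoint_orthonormal_eigenvectors[of "(*v) A" "CARD('n)"]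
      symmetric_matrix_inner[OF assms] by auto
  obtain e where e: "bij_betw e (UNIV :: 'n set) B"
    using finite_same_card_bij[of "UNIV :: 'n set" B] B by auto
  have eB: "e i \<in> B" for i using e by (auto simp: bij_betw_def)
  have "\<exists>l. A *v e i = l *\<^sub>R e i" for i using B(4)[OF eB] by blast
  then obtain d where d: "\<And>i. A *v e i = d i *\<^sub>R e i" by metis
  define P where "P = (\<chi> i j. e j $ i)"
  have col: "column j P = e j" for j by (simp add: P_def column_def vec_eq_iff)
  have inj: "e i \<noteq> e j" if "i \<noteq> j" for i j
    using e that by (auto simp: bij_betw_def inj_on_def)
  have P: "orthogonal_matrix P"
    unfolding orthogonal_matrix_orthonormal_columns col
    using B(3) B(4)[OF eB] eB inj by (auto simp: pairwise_def)
  have "A ** P = P ** diag_matrix d"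
  proof (subst vec_eq_iff, intro allI, subst vec_eq_iff, intro allI)
    fix i j
    have "(A ** P) $ i $ j = (A *v e j) $ i"
      by (simp add: matrix_matrix_mult_def matrix_vector_mult_def P_def)
    also have "\<dots> = (P ** diag_matrix d) $ i $ j"
      unfolding d by (simp add: matrix_matrix_mult_def P_def diag_matrix_def mult.commute
          if_distrib[of "(*) _"] cong: if_cong)
    finally show "(A ** P) $ i $ j = (P ** diag_matrix d) $ i $ j" .
  qed
  moreover have "P ** transpose P = mat 1" using P by (simp add: orthogonal_matrix_def)
  ultimately have "A = P ** diag_matrix d ** transpose P"
    by (metis matrix_mul_assoc matrix_mul_rid)
  then show thesis using that P by blast
qed

section \<open>Orthogonal conjugation and irreducible orbits\<close>

lemma norm_orthogonal_matrix_vector: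
  fixes U :: "real^'n^'n"
  assumes "orthogonal_matrix U"
  shows "norm (U *v x) = norm x"
  using assms orthogonal_transformation_norm[of "(*v) U" x]
  by (simp add: orthogonal_transformation_matrix)

lemma inner_orthogonal_matrix_vector:
  fixes U :: "real^'n^'n"
  assumes "orthogonal_matrix U"
  shows "(U *v x) \<bullet> (U *v y) = x \<bullet> y"
  using assms orthogonal_transformation_matrix[of "(*v) U"]
  by (simp add: orthogonal_transformation_def)

lemma norm_matrix_transpose: "norm (transpose A) = norm (A :: real^'n^'n)"
proof -
  have "transpose A \<bullet> transpose A = A \<bullet> A"
    unfolding inner_vec_def transpose_def by (simp, subst sum.swap, simp)
  then show ?thesis by (simp add: norm_eq_sqrt_inner)
qed

text \<open>The norm on nested vectors is the Frobenius norm, and right multiplication acts on each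
  row by an orthogonal matrix. This makes conjugation an isometry of the space of matrices, as the
  nearest-point argument requires.\<close>

lemma norm_matrix_mult_orthogonal:
  fixes A U :: "real^'n^'n"
  assumes "orthogonal_matrix U"
  shows "norm (A ** U) = norm A"
proof -
  have "(A ** U) $ i = transpose U *v (A $ i)" for i
    by (simp add: vec_eq_iff matrix_matrix_mult_def matrix_vector_mult_def transpose_def mult.commute)
  then have "norm ((A ** U) $ i) = norm (A $ i)" for i
    using norm_orthogonal_matrix_vector[of "transpose U"] assms by simp
  then show ?thesis by (simp add: norm_vec_def)
qed

lemma norm_orthogonal_conjugate:
  fixes A U :: "real^'n^'n"
  assumes "orthogonal_matrix U"
  shows "norm (transpose U ** A ** U) = norm A"
proof -
  have "norm (transpose U ** A ** U) = norm (transpose U ** A)"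
    using norm_matrix_mult_orthogonal[OF assms] by blast
  also have "\<dots> = norm (transpose (transpose A ** U))" by (simp add: matrix_transpose_mul)
  also have "\<dots> = norm A"
    by (simp only: norm_matrix_transpose norm_matrix_mult_orthogonal[OF assms])
  finally show ?thesis .
qed

lemma trace_orthogonal_conjugate:
  fixes A U :: "real^'n^'n"
  assumes "orthogonal_matrix U"
  shows "trace (transpose U ** A ** U) = trace A"
proof -
  have "trace (transpose U ** A ** U) = trace (U ** (transpose U ** A))"
    by (rule trace_mul_sym)
  then show ?thesis using assms by (simp add: matrix_mul_assoc orthogonal_matrix_def)
qed

lemma irreducible_orbit_span:
  assumes "orthogonal_matrix_group G" "irreducible_matrix_group G" "z \<noteq> 0"
  shows "span ((\<lambda>U. U *v z) ` G) = UNIV"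
proof -
  let ?S = "span ((\<lambda>U. U *v z) ` G)"
  have "linear_image V ?S \<subseteq> ?S" if "V \<in> G" for V
  proof -
    have "linear_image V ?S = span ((*v) V ` ((\<lambda>U. U *v z) ` G))"
      unfolding linear_image_def by (simp add: linear_span_image)
    also have "(*v) V ` ((\<lambda>U. U *v z) ` G) \<subseteq> (\<lambda>U. U *v z) ` G"
      using assms(1) that by (auto simp: orthogonal_matrix_group_def matrix_vector_mul_assoc)
    then have "span ((*v) V ` ((\<lambda>U. U *v z) ` G)) \<subseteq> ?S" by (rule span_mono)
    finally show ?thesis .
  qed
  then have "?S = {0} \<or> ?S = UNIV"
    using assms(2) unfolding irreducible_matrix_group_def by (meson subspace_span)
  moreover have "mat 1 *v z \<in> ?S"
    using assms(1) by (intro span_base imageI) (simp add: orthogonal_matrix_group_def)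
  ultimately show ?thesis using assms(3) by auto
qed

text \<open>Schur's lemma over the reals. Symmetry matters: it provides a real eigenvector, whereas
  plane rotations, for instance, commute with non-scalar matrices. The eigenspace is invariant under
  \<open>G\<close>, hence contains an orbit and is everything.\<close>

lemma invariant_symmetric_matrix_scalar:
  fixes X :: "real^'n^'n"
  assumes G: "orthogonal_matrix_group G" "irreducible_matrix_group G"
    and X: "transpose X = X" and inv: "\<And>W. W \<in> G \<Longrightarrow> transpose W ** X ** W = X"
  obtains c where "X = c *\<^sub>R mat 1"
proof -
  obtain v l where v: "norm v = 1" "X *v v = l *\<^sub>R v"
    using self_adjoint_eigenvector[of "(*v) X" UNIV] symmetric_matrix_inner[OF X]
    by (metis UNIV_I matrix_vector_mul_linear subspace_UNIV UNIV_not_singleton)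
  have "X *v (W *v v) = l *\<^sub>R (W *v v)" if "W \<in> G" for W
  proof -
    have "W ** transpose W = mat 1"
      using G(1) that by (auto simp: orthogonal_matrix_group_def orthogonal_matrix_def)
    then have "X ** W = W ** X"
      using inv[OF that] by (metis matrix_mul_assoc matrix_mul_lid)
    then show ?thesis by (metis v(2) matrix_vector_mul_assoc matrix_vector_mult_scaleR)
  qed
  then have "(\<lambda>W. W *v v) ` G \<subseteq> {x. X *v x = l *\<^sub>R x}" by auto
  moreover have "subspace {x. X *v x = l *\<^sub>R x}"
    unfolding subspace_def
    by (auto simp: matrix_vector_right_distrib matrix_vector_mult_scaleR scaleR_right_distrib)
  ultimately have "span ((\<lambda>W. W *v v) ` G) \<subseteq> {x. X *v x = l *\<^sub>R x}" by (rule span_minimal)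
  moreover have "v \<noteq> 0" using v(1) by auto
  ultimately have "X *v x = (l *\<^sub>R mat 1) *v x" for x
    using irreducible_orbit_span[OF G, of v] by (auto simp: scaleR_matrix_vector_assoc[symmetric])
  then have "X = l *\<^sub>R mat 1" by (simp add: matrix_eq)
  then show thesis using that by blast
qed

text \<open>The point \<open>X\<close> of least norm in the closed hull is unique. Conjugation by a
  member of \<open>G\<close> preserves both the hull and the norm, so it fixes \<open>X\<close>;
  thus \<open>X\<close> is scalar, and its trace 0 makes it 0.\<close>

lemma zero_in_closed_hull_of_conjugates:
  fixes L :: "real^'n^'n"
  assumes G: "orthogonal_matrix_group G" "irreducible_matrix_group G"
    and L: "transpose L = L" "trace L = 0"
  shows "0 \<in> closure (convex hull ((\<lambda>W. transpose W ** L ** W) ` G))" (is "0 \<in> closure (convex hull ?A)")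
proof -
  let ?C = "closure (convex hull ?A)"
  define X where "X = closest_point ?C 0"
  have "mat 1 \<in> G" using G(1) by (simp add: orthogonal_matrix_group_def)
  then have ne: "?C \<noteq> {}" by auto
  have XC: "X \<in> ?C" unfolding X_def by (rule closest_point_in_set[OF closed_closure ne])
  \<comment> \<open>Symmetry and zero trace are closed linear conditions, so they pass from the
    conjugates to the closed hull.\<close>
  have sub: "?C \<subseteq> {Y. transpose Y = Y \<and> trace Y = 0}"
  proof (intro closure_minimal hull_minimal)
    show "?A \<subseteq> {Y. transpose Y = Y \<and> trace Y = 0}"
      using G(1) L by (auto simp: orthogonal_matrix_group_def trace_orthogonal_conjugate
          matrix_transpose_mul matrix_mul_assoc)
    have "{Y :: real^'n^'n. transpose Y = Y \<and> trace Y = 0} =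
        {Y. (\<forall>i j. Y $ j $ i = Y $ i $ j) \<and> (\<Sum>i\<in>UNIV. Y $ i $ i) = 0}"
      by (auto simp: vec_eq_iff transpose_def trace_def)
    moreover have "convex \<dots>" by (auto simp: convex_def sum.distrib sum_distrib_left[symmetric])
    moreover have "closed {Y :: real^'n^'n. (\<forall>i j. Y $ j $ i = Y $ i $ j) \<and> (\<Sum>i\<in>UNIV. Y $ i $ i) = 0}"
      by (intro closed_Collect_conj closed_Collect_all closed_Collect_eq continuous_intros)
    ultimately show "convex {Y :: real^'n^'n. transpose Y = Y \<and> trace Y = 0}"
      and "closed {Y :: real^'n^'n. transpose Y = Y \<and> trace Y = 0}" by simp_all
  qed
  have "transpose V ** X ** V = X" if V: "V \<in> G" for V
  proof -
    let ?f = "\<lambda>Y. transpose V ** Y ** V"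
    have lin: "linear ?f"
      by (intro linearI) (simp_all add: vec_eq_iff matrix_matrix_mult_def sum.distrib
          sum_distrib_left sum_distrib_right algebra_simps)
    have "?f ` ?A \<subseteq> ?A"
    proof clarify
      fix W assume "W \<in> G"
      then have "W ** V \<in> G" using G(1) V by (auto simp: orthogonal_matrix_group_def)
      then show "?f (transpose W ** L ** W) \<in> ?A"
        by (intro image_eqI[of _ _ "W ** V"]) (simp_all add: matrix_transpose_mul matrix_mul_assoc)
    qed
    then have "?f ` (convex hull ?A) \<subseteq> convex hull ?A"
      unfolding convex_hull_linear_image[OF lin] by (rule hull_mono)
    then have "?f ` ?C \<subseteq> ?C"
      using closure_bounded_linear_image_subset[of ?f "convex hull ?A"] lin
        closure_mono[of "?f ` (convex hull ?A)" "convex hull ?A"]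
      by (simp add: linear_conv_bounded_linear)
    then have "?f X \<in> ?C" using XC by blast
    moreover have "norm (?f X) = norm X"
      using G(1) V by (auto simp: orthogonal_matrix_group_def norm_orthogonal_conjugate)
    then have "dist 0 (?f X) \<le> dist 0 Y" if "Y \<in> ?C" for Y
      using closest_point_le[OF closed_closure that, of 0] by (simp add: X_def)
    moreover have "convex ?C" by (intro convex_closure convex_convex_hull)
    ultimately show ?thesis
      unfolding X_def by (intro closest_point_unique) auto
  qed
  moreover have "transpose X = X" "trace X = 0" using sub XC by auto
  ultimately obtain c where c: "X = c *\<^sub>R mat 1"
    using invariant_symmetric_matrix_scalar[OF G] by blast
  have "trace X = c * real CARD('n)" by (simp add: c trace_def mat_def)
  then have "c = 0" using \<open>trace X = 0\<close> by simp
  then show ?thesis using XC c by simp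
qed

section \<open>Concavity of the logarithm and eigenvectors\<close>

text \<open>Applying ln x <= x - 1 to the square roots \<open>s\<close>, \<open>r\<close> of
  \<open>a\<close>, \<open>m\<close> instead of to \<open>a / m\<close> yields a quadratic term: 2
  (s/r - 1) = (a - m)/m - (s - r)^2/m. The factor 4 B^2 bounds m (s + r)^2, which converts (s - r)^2
  into (a - m)^2.\<close>

lemma ln_le_tangent_minus_square:
  fixes a m B :: real
  assumes "0 < a" "a \<le> B" "0 < m" "m \<le> B"
  shows "ln a \<le> ln m + (a - m) / m - (a - m)\<^sup>2 / (4 * B\<^sup>2)"
proof -
  define s r where "s = sqrt a" and "r = sqrt m"
  have sr: "s > 0" "r > 0" "a = s\<^sup>2" "m = r\<^sup>2" using assms by (auto simp: s_def r_def)
  have "ln (s / r) \<le> s / r - 1" using sr by (intro ln_le_minus_one) simp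
  moreover have "ln a - ln m = 2 * ln (s / r)"
    using sr by (simp add: ln_div ln_realpow)
  moreover have "2 * (s / r - 1) = (a - m) / m - (s - r)\<^sup>2 / m"
    using sr by (simp add: field_simps power2_eq_square)
  moreover have "(a - m)\<^sup>2 / (4 * B\<^sup>2) \<le> (s - r)\<^sup>2 / m"
  proof -
    have "(s + r)\<^sup>2 \<le> 2 * (s\<^sup>2 + r\<^sup>2)"
      using zero_le_power2[of "s - r"] by (simp add: power2_eq_square algebra_simps)
    then have "(s + r)\<^sup>2 * m \<le> (4 * B) * B"
      using assms sr by (intro mult_mono) (simp_all add: order.trans[OF less_imp_le[OF assms(1)] assms(2)])
    then have "(s - r)\<^sup>2 * ((s + r)\<^sup>2 * m) \<le> (s - r)\<^sup>2 * (4 * B\<^sup>2)"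
      by (intro mult_left_mono) (auto simp: power2_eq_square)
    moreover have "(a - m)\<^sup>2 = (s - r)\<^sup>2 * (s + r)\<^sup>2"
      by (simp add: sr power2_eq_square algebra_simps)
    ultimately have "(a - m)\<^sup>2 * m \<le> (s - r)\<^sup>2 * (4 * B\<^sup>2)" by (simp add: mult.assoc)
    then show ?thesis using assms by (simp add: divide_simps mult.commute)
  qed
  ultimately have "ln a - ln m \<le> (a - m) / m - (a - m)\<^sup>2 / (4 * B\<^sup>2)"
    by (smt (verit))
  then show ?thesis by simp
qed

text \<open>Jensen's inequality with a variance remainder: the tangent estimate at the mean
  \<open>m\<close> is averaged, and its linear terms cancel.\<close>

lemma ln_weighted_mean_lower_bound:
  fixes w d :: "'n::finite \<Rightarrow> real"
  assumes w: "\<And>i. w i \<ge> 0" "(\<Sum>i\<in>UNIV. w i) = 1" and d: "\<And>i. 0 < d i" "\<And>i. d i \<le> B"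
  shows "ln (\<Sum>i\<in>UNIV. w i * d i) \<ge> (\<Sum>i\<in>UNIV. w i * ln (d i))
           + ((\<Sum>i\<in>UNIV. w i * (d i)\<^sup>2) - (\<Sum>i\<in>UNIV. w i * d i)\<^sup>2) / (4 * B\<^sup>2)"
proof -
  define m where "m = (\<Sum>i\<in>UNIV. w i * d i)"
  obtain i where i: "w i \<noteq> 0" using w(2) by force
  have "0 < w i * d i" using i w(1)[of i] d(1)[of i] by simp
  also have "\<dots> \<le> m" unfolding m_def
    using w(1) d(1) by (intro member_le_sum) (auto intro: mult_nonneg_nonneg less_imp_le)
  finally have m0: "m > 0" .
  have "m \<le> (\<Sum>i\<in>UNIV. w i * B)" unfolding m_def
    using w(1) d(2) by (intro sum_mono mult_left_mono) auto
  then have mB: "m \<le> B" using w(2) by (simp add: sum_distrib_right[symmetric])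
  have "(\<Sum>i\<in>UNIV. w i * ln (d i))
      \<le> (\<Sum>i\<in>UNIV. w i * (ln m + (d i - m) / m - (d i - m)\<^sup>2 / (4 * B\<^sup>2)))"
    using w(1) d m0 mB by (intro sum_mono mult_left_mono ln_le_tangent_minus_square) auto
  also have "\<dots> = (\<Sum>i\<in>UNIV. w i * (ln m - 1 - m\<^sup>2 / (4 * B\<^sup>2)) + w i * d i * (1 / m + 2 * m / (4 * B\<^sup>2))
       - w i * (d i)\<^sup>2 * (1 / (4 * B\<^sup>2)))"
    using m0 mB by (intro sum.cong) (auto simp: field_simps power2_eq_square)
  also have "\<dots> = (ln m - 1 - m\<^sup>2 / (4 * B\<^sup>2)) + m * (1 / m + 2 * m / (4 * B\<^sup>2))
       - (\<Sum>i\<in>UNIV. w i * (d i)\<^sup>2) * (1 / (4 * B\<^sup>2))"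
    by (simp only: sum.distrib sum_subtractf sum_distrib_right[symmetric] w(2) m_def[symmetric] mult_1)
  also have "\<dots> = ln m - ((\<Sum>i\<in>UNIV. w i * (d i)\<^sup>2) - m\<^sup>2) / (4 * B\<^sup>2)"
    using m0 mB by (simp add: field_simps power2_eq_square)
  finally show ?thesis by (simp add: m_def)
qed

text \<open>The Cauchy--Schwarz defect of \<open>z\<close> and \<open>A z\<close>: it vanishes exactly on the eigenvectors of \<open>A\<close>.\<close>

definition eigen_defect :: "real^'n^'n \<Rightarrow> real^'n \<Rightarrow> real" where
  "eigen_defect A z = (norm z)\<^sup>2 * (norm (A *v z))\<^sup>2 - ((A *v z) \<bullet> z)\<^sup>2"

lemma eigen_defect_nonneg: "eigen_defect A z \<ge> 0"
  using Cauchy_Schwarz_ineq[of "A *v z" z]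
  by (simp add: eigen_defect_def power2_norm_eq_inner mult.commute)

lemma eigen_defect_zero:
  assumes "eigen_defect A z = 0"
  obtains l where "A *v z = l *\<^sub>R z"
proof (cases "z = 0")
  case True
  then show thesis using that[of 0] by simp
next
  case False
  have "((A *v z) \<bullet> z)\<^sup>2 = (norm (A *v z) * norm z)\<^sup>2"
    using assms by (simp add: eigen_defect_def power_mult_distrib mult.commute)
  then have "\<bar>z \<bullet> (A *v z)\<bar> = norm z * norm (A *v z)"
    by (metis (no_types) abs_mult abs_norm_cancel inner_commute mult.commute real_sqrt_abs)
  then have "collinear {0, z, A *v z}" by (simp add: norm_cauchy_schwarz_equal)
  then show thesis using False that by (auto simp: collinear_lemma)
qed

lemma transpose_mult_self_inner:
  fixes M :: "real^'n^'n"
  shows "((transpose M ** M) *v x) \<bullet> y = (M *v x) \<bullet> (M *v y)"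
  by (simp add: transpose_matrix_vector dot_lmul_matrix flip: matrix_vector_mul_assoc)

text \<open>In eigencoordinates of \<open>M\<^sup>T M\<close>, the squared coordinates of z/|z| are
  weights \<open>w\<close>, and |Mz|^2/|z|^2 is the weighted mean of the eigenvalues
  \<open>d\<close>. Jensen's main term is the quadratic form of \<open>L\<close>, and the variance
  is the normalized eigen-defect.\<close>

lemma ln_norm_ratio_lower_bound:
  fixes M :: "real^'n^'n"
  assumes det: "det M = 1 \<or> det M = -1"
  obtains L c where "transpose L = L" "trace L = 0" "c > 0"
    "\<And>z. z \<noteq> 0 \<Longrightarrow> ln (norm (M *v z) / norm z) \<ge>
       z \<bullet> (L *v z) / (norm z)\<^sup>2 + c * eigen_defect (transpose M ** M) z / (norm z) ^ 4"
proof -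
  define T where "T = transpose M ** M"
  have "transpose T = T" by (simp add: T_def matrix_transpose_mul)
  then obtain P d where P: "orthogonal_matrix P" and T: "T = P ** diag_matrix d ** transpose P"
    by (rule symmetric_matrix_diagonalization)
  have PP: "P ** transpose P = mat 1" "transpose P ** P = mat 1"
    using P by (auto simp: orthogonal_matrix_def)
  have Pt: "orthogonal_matrix (transpose P)" using P by simp
  have conj_vec: "transpose P *v ((P ** diag_matrix f ** transpose P) *v z) = diag_matrix f *v (transpose P *v z)"
    for f z
    by (simp only: matrix_vector_mul_assoc matrix_mul_assoc PP matrix_mul_lid)
  have quad: "z \<bullet> ((P ** diag_matrix f ** transpose P) *v z) = (\<Sum>i\<in>UNIV. f i * ((transpose P *v z) $ i)\<^sup>2)"
    for f z
    using inner_orthogonal_matrix_vector[OF Pt, of z "(P ** diag_matrix f ** transpose P) *v z"]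
    unfolding conj_vec by (simp add: inner_vec_def power2_eq_square mult_ac)
  have normT: "(norm (T *v z))\<^sup>2 = (\<Sum>i\<in>UNIV. (d i)\<^sup>2 * ((transpose P *v z) $ i)\<^sup>2)" for z
    using inner_orthogonal_matrix_vector[OF Pt, of "T *v z" "T *v z"]
    unfolding T conj_vec
    by (simp add: power2_norm_eq_inner) (simp add: inner_vec_def power2_eq_square mult_ac)
  have normz: "(norm z)\<^sup>2 = (\<Sum>i\<in>UNIV. ((transpose P *v z) $ i)\<^sup>2)" for z
    using inner_orthogonal_matrix_vector[OF Pt, of z z]
    by (simp add: power2_norm_eq_inner) (simp add: inner_vec_def power2_eq_square)
  have Mz: "(norm (M *v z))\<^sup>2 = (\<Sum>i\<in>UNIV. d i * ((transpose P *v z) $ i)\<^sup>2)" for z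
    using quad[of z d] transpose_mult_self_inner[of M z z]
    by (simp add: power2_norm_eq_inner T_def[symmetric] T[symmetric] inner_commute)
  \<comment> \<open>Each \<open>d i\<close> is the squared length of the image of a unit eigenvector
    under \<open>M\<close>; it becomes positive because the product of all of them is 1.\<close>
  have "d i \<ge> 0" for i
  proof -
    have "transpose P *v (P *v axis i 1) = axis i 1"
      by (simp add: matrix_vector_mul_assoc PP)
    then have "(norm (M *v (P *v axis i 1)))\<^sup>2 = (\<Sum>j\<in>UNIV. d j * (axis i 1 $ j)\<^sup>2)"
      using Mz[of "P *v axis i 1"] by simp
    also have "\<dots> = d i" by (simp add: axis_def if_distrib[of "\<lambda>u. u\<^sup>2"] if_distrib[of "(*) _"] cong: if_cong)
    finally show ?thesis by (metis zero_le_power2)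
  qed
  moreover have prod: "(\<Prod>i\<in>UNIV. d i) = 1"
  proof -
    have "det T = 1" using det by (auto simp: T_def det_mul det_transpose)
    moreover have "det T = det (P ** transpose P) * det (diag_matrix d)"
      by (simp add: T det_mul)
    moreover have "det (diag_matrix d) = (\<Prod>i\<in>UNIV. d i)"
      by (subst det_diagonal) (auto simp: diag_matrix_def)
    ultimately show ?thesis by (simp add: PP det_I)
  qed
  ultimately have d: "d i > 0" for i
    by (metis UNIV_I finite_class.finite_UNIV less_eq_real_def prod_zero zero_neq_one)
  define B where "B = Max (range d)"
  have B: "d i \<le> B" for i by (simp add: B_def)
  have B0: "B > 0" using d[of undefined] B[of undefined] by linarith
  define L where "L = P ** diag_matrix (\<lambda>i. ln (d i) / 2) ** transpose P"
  have td: "transpose (diag_matrix f) = diag_matrix f" for f :: "'n \<Rightarrow> real"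
    by (auto simp: transpose_def diag_matrix_def vec_eq_iff)
  show thesis
  proof (rule that)
    show "transpose L = L" by (simp add: L_def matrix_transpose_mul td matrix_mul_assoc)
    have "trace L = trace (diag_matrix (\<lambda>i. ln (d i) / 2))"
      using trace_orthogonal_conjugate[OF Pt, of "diag_matrix (\<lambda>i. ln (d i) / 2)"] by (simp add: L_def)
    also have "\<dots> = ln (\<Prod>i\<in>UNIV. d i) / 2"
      using d by (subst ln_prod) (simp_all add: trace_def diag_matrix_def less_imp_neq[symmetric] sum_divide_distrib)
    finally show "trace L = 0" by (simp add: prod)
    \<comment> \<open>Half of the constant \<open>1 / (4 * B\<^sup>2)\<close> of Jensen's remainder,
      since ln |Mz| is half of ln |Mz|^2. The same half appears in \<open>L\<close>.\<close>
    show "1 / (8 * B\<^sup>2) > 0" using B0 by simp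
    fix z :: "real^'n" assume z: "z \<noteq> 0"
    define y where "y = transpose P *v z"
    define N where "N = (norm z)\<^sup>2"
    define w where "w = (\<lambda>i. (y $ i)\<^sup>2 / N)"
    have N0: "N > 0" using z by (simp add: N_def)
    have w: "w i \<ge> 0" "(\<Sum>i\<in>UNIV. w i) = 1" for i
      using N0 normz[of z] by (auto simp: w_def y_def N_def simp flip: sum_divide_distrib)
    have "M *v z \<noteq> 0"
    proof
      assume "M *v z = 0"
      moreover have "invertible M" using det by (auto simp: invertible_det_nz)
      ultimately show False
        using z by (metis invertible_def matrix_vector_mul_assoc matrix_vector_mul_lid matrix_vector_mult_0_right)
    qed
    then have "ln (norm (M *v z) / norm z) = ln ((norm (M *v z))\<^sup>2 / N) / 2"
      using z by (simp add: N_def ln_div ln_realpow)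
    also have "(norm (M *v z))\<^sup>2 / N = (\<Sum>i\<in>UNIV. w i * d i)"
      by (simp add: Mz w_def y_def sum_divide_distrib mult.commute)
    finally have 1: "ln (norm (M *v z) / norm z) = ln (\<Sum>i\<in>UNIV. w i * d i) / 2" .
    have 2: "z \<bullet> (L *v z) / (norm z)\<^sup>2 = (\<Sum>i\<in>UNIV. w i * ln (d i)) / 2"
      by (simp add: L_def quad w_def y_def N_def sum_divide_distrib mult_ac)
    \<comment> \<open>Second moment minus squared mean of \<open>d\<close> under the weights
      \<open>w\<close>, that is, the variance.\<close>
    have "eigen_defect T z / N\<^sup>2 = (norm (T *v z))\<^sup>2 / N - ((T *v z) \<bullet> z / N)\<^sup>2"
      using N0 by (simp add: eigen_defect_def N_def diff_divide_distrib power2_eq_square)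
    also have "(norm (T *v z))\<^sup>2 / N = (\<Sum>i\<in>UNIV. w i * (d i)\<^sup>2)"
      by (simp add: normT w_def y_def sum_divide_distrib mult.commute)
    also have "(T *v z) \<bullet> z / N = (\<Sum>i\<in>UNIV. w i * d i)"
      by (simp add: inner_commute T quad w_def y_def sum_divide_distrib mult.commute)
    finally have 3: "eigen_defect T z / N\<^sup>2 = (\<Sum>i\<in>UNIV. w i * (d i)\<^sup>2) - (\<Sum>i\<in>UNIV. w i * d i)\<^sup>2" .
    have 4: "(norm z) ^ 4 = N\<^sup>2" by (simp add: N_def)
    have "1 / (8 * B\<^sup>2) * eigen_defect T z / (norm z) ^ 4 = (eigen_defect T z / N\<^sup>2) / (4 * B\<^sup>2) / 2"
      by (simp add: 4)
    with 1 2 ln_weighted_mean_lower_bound[of w d B, OF w d B] show "ln (norm (M *v z) / norm z) \<ge>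
       z \<bullet> (L *v z) / (norm z)\<^sup>2 + 1 / (8 * B\<^sup>2) * eigen_defect (transpose M ** M) z / (norm z) ^ 4"
      unfolding 3 T_def[symmetric] by (simp add: add_divide_distrib)
  qed
qed

section \<open>A uniform lower bound for the eigen-defect\<close>

text \<open>Applied in the space of matrices, this replaces the group by finitely many members: any
  condition on a matrix that defines a subspace extends from \<open>F\<close> to all of
  \<open>G\<close>.\<close>

lemma finite_spanning_subset:
  fixes G :: "'a::euclidean_space set"
  assumes "u \<in> G"
  obtains F where "finite F" "u \<in> F" "F \<subseteq> G" "G \<subseteq> span F"
proof -
  obtain B where B: "B \<subseteq> G" "independent B" "G \<subseteq> span B" using basis_exists by metis
  show thesis
  proof (rule that)
    show "finite (insert u B)" using independent_imp_finite[OF B(2)] by simp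
    show "G \<subseteq> span (insert u B)" using B(3) span_mono[of B "insert u B"] by auto
  qed (use B assms in auto)
qed

text \<open>Eigenvectors with distinct eigenvalues are independent, and then their difference is not
  an eigenvector; so \<open>u\<close> and \<open>v\<close> share the eigenvalue
  \<open>l\<close>.\<close>

lemma eigenvectors_of_triangle:
  fixes A :: "real^'n^'n"
  assumes "A *v u = l *\<^sub>R u" "u \<noteq> 0" "A *v v = k *\<^sub>R v" "A *v (v - u) = r *\<^sub>R (v - u)"
  shows "A *v v = l *\<^sub>R v"
proof (rule ccontr)
  assume neq: "A *v v \<noteq> l *\<^sub>R v"
  then have v: "v \<noteq> 0" and kl: "k \<noteq> l" using assms(3) by auto
  have "k *\<^sub>R v - l *\<^sub>R u = r *\<^sub>R (v - u)"
    using assms by (simp add: matrix_vector_mult_diff_distrib)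
  then have eq: "(k - r) *\<^sub>R v = (l - r) *\<^sub>R u" by (simp add: algebra_simps)
  then have kr: "k \<noteq> r" using kl assms(2) by auto
  have "v = ((l - r) / (k - r)) *\<^sub>R u"
    using arg_cong[OF eq, of "\<lambda>x. (1 / (k - r)) *\<^sub>R x"] kr by simp
  then have "A *v v = l *\<^sub>R v"
    using assms(1) by (metis matrix_vector_mult_scaleR scaleR_left_commute)
  then show False using neq by blast
qed

text \<open>If every defect vanished, all the differences would be eigenvectors. The triangle
  argument gives them one common eigenvalue, irreducibility makes \<open>M\<^sup>T M\<close> scalar,
  and the determinant makes it the identity.\<close>

lemma exists_positive_defect:
  fixes M W :: "real^'n^'n"
  assumes G: "orthogonal_matrix_group G" "irreducible_matrix_group G"
    and F: "mat 1 \<in> F" "F \<subseteq> G" "G \<subseteq> span F"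
    and det: "det M = 1 \<or> det M = -1" and M: "\<not> orthogonal_matrix M"
    and W: "orthogonal_matrix W" and ab: "a \<noteq> b"
  shows "\<exists>U\<in>F. \<exists>V\<in>F. \<exists>x\<in>{a,b}. \<exists>y\<in>{a,b}. eigen_defect (transpose M ** M) (W *v (U *v x - V *v y)) > 0"
proof (rule ccontr)
  define T where "T = transpose M ** M"
  assume neg: "\<not> (\<exists>U\<in>F. \<exists>V\<in>F. \<exists>x\<in>{a,b}. \<exists>y\<in>{a,b}. eigen_defect (transpose M ** M) (W *v (U *v x - V *v y)) > 0)"
  have "eigen_defect T (W *v (U *v x - V *v y)) = 0"
    if "U \<in> F" "V \<in> F" "x \<in> {a, b}" "y \<in> {a, b}" for U V x y
  proof -
    have "\<not> eigen_defect T (W *v (U *v x - V *v y)) > 0"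
      using neg that unfolding T_def by blast
    then show ?thesis using eigen_defect_nonneg[of T "W *v (U *v x - V *v y)"] by linarith
  qed
  then have eig: "\<exists>l. T *v (W *v (U *v x - V *v y)) = l *\<^sub>R (W *v (U *v x - V *v y))"
    if "U \<in> F" "V \<in> F" "x \<in> {a, b}" "y \<in> {a, b}" for U V x y
    using that eigen_defect_zero by metis
  have WW: "transpose W ** W = mat 1" using W by (simp add: orthogonal_matrix)
  have Winj: "W *v x = 0 \<longleftrightarrow> x = 0" for x
    using norm_orthogonal_matrix_vector[OF W, of x] by (metis norm_eq_zero)
  \<comment> \<open>All points are viewed from \<open>b\<close>. The vector to \<open>a\<close>
    fixes the eigenvalue \<open>l\<close>, and the triangle formed by \<open>b\<close>,
    \<open>a\<close> and \<open>U x\<close> transfers \<open>l\<close> to the vector to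
    \<open>U x\<close>.\<close>
  let ?q = "\<lambda>x. W *v (x - b)"
  obtain l where l: "T *v ?q a = l *\<^sub>R ?q a"
    using eig[of "mat 1" "mat 1" a b] F(1) by auto
  have line: "T *v ?q (U *v x) = l *\<^sub>R ?q (U *v x)" if Ux: "U \<in> F" "x \<in> {a, b}" for U x
  proof -
    obtain k where k: "T *v ?q (U *v x) = k *\<^sub>R ?q (U *v x)"
      using eig[of U "mat 1" x b] F(1) Ux by auto
    have d: "?q (U *v x) - ?q a = W *v (U *v x - mat 1 *v a)"
      by (simp add: matrix_vector_mult_diff_distrib)
    obtain r where r: "T *v (?q (U *v x) - ?q a) = r *\<^sub>R (?q (U *v x) - ?q a)"
      unfolding d using eig[of U "mat 1" x a] F(1) Ux by auto
    then show ?thesis using eigenvectors_of_triangle[OF l _ k r] ab by (simp add: Winj)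
  qed
  \<comment> \<open>The eigenvalue equation is linear in the matrix \<open>X\<close>, so it carries
    over from \<open>F\<close> to the span of \<open>F\<close>, which contains
    \<open>G\<close>.\<close>
  define E where "E = {X. T *v (W *v (X *v (a - b))) = l *\<^sub>R (W *v (X *v (a - b)))}"
  have "F \<subseteq> E"
  proof
    fix U assume U: "U \<in> F"
    have "W *v (U *v (a - b)) = ?q (U *v a) - ?q (U *v b)"
      by (simp add: matrix_vector_mult_diff_distrib)
    then show "U \<in> E" using line[OF U, of a] line[OF U, of b]
      by (simp add: E_def matrix_vector_mult_diff_distrib[of T] scaleR_diff_right)
  qed
  moreover have "subspace E"
    unfolding E_def subspace_def
    by (auto simp: matrix_vector_mult_add_rdistrib matrix_vector_right_distrib scaleR_right_distrib
        matrix_vector_mult_scaleR scaleR_matrix_vector_assoc[symmetric])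
  ultimately have "G \<subseteq> E" using F(3) span_minimal by blast
  then have "(\<lambda>U. U *v (a - b)) ` G \<subseteq> {x. T *v (W *v x) = l *\<^sub>R (W *v x)}"
    by (auto simp: E_def)
  moreover have "subspace {x. T *v (W *v x) = l *\<^sub>R (W *v x)}"
    unfolding subspace_def
    by (auto simp: matrix_vector_right_distrib matrix_vector_mult_scaleR scaleR_right_distrib)
  ultimately have "span ((\<lambda>U. U *v (a - b)) ` G) \<subseteq> {x. T *v (W *v x) = l *\<^sub>R (W *v x)}"
    by (rule span_minimal)
  then have TW: "T *v (W *v x) = l *\<^sub>R (W *v x)" for x
    using irreducible_orbit_span[OF G, of "a - b"] ab by auto
  have "W ** transpose W = mat 1" using W by (simp add: orthogonal_matrix_def)
  then have "W *v (transpose W *v x) = x" for x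
    by (simp only: matrix_vector_mul_assoc matrix_vector_mul_lid)
  then have "T *v x = l *\<^sub>R x" for x using TW[of "transpose W *v x"] by metis
  then have T: "T = l *\<^sub>R mat 1" by (simp add: matrix_eq scaleR_matrix_vector_assoc[symmetric])
  have "det T = 1" using det by (auto simp: T_def det_mul det_transpose)
  moreover have "det T = l ^ CARD('n)"
    unfolding T by (subst det_diagonal) (auto simp: mat_def)
  \<comment> \<open>In even dimension, the determinant alone would also admit
    \<open>l = -1\<close>.\<close>
  moreover have "l \<ge> 0"
  proof -
    have "l * (norm (a - b))\<^sup>2 = (norm (M *v (a - b)))\<^sup>2"
      using \<open>\<And>x. T *v x = l *\<^sub>R x\<close>[of "a - b"] transpose_mult_self_inner[of M "a - b" "a - b"]
      by (simp add: T_def power2_norm_eq_inner)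
    then show ?thesis using ab
      by (metis right_minus_eq zero_le_power2 zero_less_norm_iff zero_less_power zero_le_mult_iff not_le)
  qed
  ultimately have "l = 1"
    by (metis power_eq_1_iff real_norm_def abs_of_nonneg zero_less_card_finite less_irrefl)
  then show False using M T by (simp add: T_def orthogonal_matrix)
qed

lemma continuous_on_matrix_vector_mult [continuous_intros]:
  fixes f :: "'a::topological_space \<Rightarrow> real^'n^'m"
  assumes "continuous_on S f" "continuous_on S g"
  shows "continuous_on S (\<lambda>x. f x *v g x)"
  unfolding matrix_vector_mult_def
  by (intro continuous_on_vec_lambda continuous_intros assms)

lemma continuous_on_eigen_defect [continuous_intros]:
  assumes "continuous_on S f"
  shows "continuous_on S (\<lambda>x. eigen_defect A (f x))"
  unfolding eigen_defect_def by (intro continuous_intros assms)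

lemma compact_orthogonal_matrices: "compact {W :: real^'n^'n. orthogonal_matrix W}"
proof -
  have "bounded {W :: real^'n^'n. orthogonal_matrix W}"
    unfolding bounded_iff
  proof (intro exI ballI)
    fix W :: "real^'n^'n" assume "W \<in> {W. orthogonal_matrix W}"
    then have W: "orthogonal_matrix W" by simp
    have "norm W = norm (mat 1 ** W)" by simp
    also have "\<dots> = norm (mat 1 :: real^'n^'n)" by (rule norm_matrix_mult_orthogonal[OF W])
    finally show "norm W \<le> norm (mat 1 :: real^'n^'n)" by simp
  qed
  moreover have "closed {W :: real^'n^'n. orthogonal_matrix W}"
    unfolding orthogonal_matrix matrix_matrix_mult_def transpose_def
    by (intro closed_Collect_eq continuous_on_vec_lambda continuous_intros)
  ultimately show ?thesis by (simp add: compact_eq_bounded_closed)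
qed

text \<open>The sum \<open>h\<close> of all the defects is continuous and positive on a compact set
  of triples, so it has a positive minimum, and some summand reaches the average. \<open>W\<close>
  ranges over all orthogonal matrices to ensure compactness; the condition
  \<open>r \<le> norm (a - b)\<close> keeps the two points apart.\<close>

lemma uniform_positive_defect:
  fixes M :: "real^'n^'n" and K :: "(real^'n) set"
  assumes G: "orthogonal_matrix_group G" "irreducible_matrix_group G"
    and F: "finite F" "mat 1 \<in> F" "F \<subseteq> G" "G \<subseteq> span F"
    and det: "det M = 1 \<or> det M = -1" and M: "\<not> orthogonal_matrix M"
    and K: "compact K" and "r > 0"
  obtains \<delta> where "\<delta> > 0"
    "\<And>W a b. orthogonal_matrix W \<Longrightarrow> a \<in> K \<Longrightarrow> b \<in> K \<Longrightarrow> r \<le> norm (a - b) \<Longrightarrow>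
      \<exists>U\<in>F. \<exists>V\<in>F. \<exists>x\<in>{a,b}. \<exists>y\<in>{a,b}. eigen_defect (transpose M ** M) (W *v (U *v x - V *v y)) \<ge> \<delta>"
proof -
  define T where "T = transpose M ** M"
  \<comment> \<open>A boolean selects the point, so that the index set \<open>I\<close> is finite
    and the same for all \<open>a\<close>, \<open>b\<close>.\<close>
  define p where "p = (\<lambda>(a :: real^'n) b (i :: (real^'n^'n) \<times> bool). fst i *v (if snd i then a else b))"
  define I where "I = (F \<times> (UNIV :: bool set)) \<times> (F \<times> (UNIV :: bool set))"
  define h where "h = (\<lambda>(W, a, b). \<Sum>ij\<in>I. eigen_defect T (W *v (p a b (fst ij) - p a b (snd ij))))"
  define C where "C = {W :: real^'n^'n. orthogonal_matrix W} \<times> ((K \<times> K) \<inter> {(a, b). r \<le> norm (a - b)})"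
  have I: "finite I" "I \<noteq> {}" using F by (auto simp: I_def)
  have range: "\<exists>U\<in>F. \<exists>V\<in>F. \<exists>x\<in>{a,b}. \<exists>y\<in>{a,b}.
      eigen_defect T (W *v (U *v x - V *v y)) \<ge> e"
    if "ij \<in> I" "eigen_defect T (W *v (p a b (fst ij) - p a b (snd ij))) \<ge> e" for W a b ij e
    using that by (force simp: I_def p_def split: if_splits)
  have pos: "h (W, a, b) > 0" if "(W, a, b) \<in> C" for W a b
  proof -
    have "orthogonal_matrix W" "a \<noteq> b" using that \<open>r > 0\<close> by (auto simp: C_def)
    from exists_positive_defect[OF G F(2-4) det M this] obtain U V x y where
      UV: "U \<in> F" "V \<in> F" "x \<in> {a,b}" "y \<in> {a,b}" "eigen_defect T (W *v (U *v x - V *v y)) > 0"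
      unfolding T_def by blast
    let ?ij = "((U, x = a), (V, y = a))"
    have "eigen_defect T (W *v (p a b (fst ?ij) - p a b (snd ?ij))) > 0"
      using UV \<open>a \<noteq> b\<close> by (auto simp: p_def)
    moreover have "?ij \<in> I" using UV by (auto simp: I_def)
    ultimately show ?thesis
      unfolding h_def using I(1) by (auto intro!: sum_pos2 eigen_defect_nonneg)
  qed
  show thesis
  proof (cases "C = {}")
    case True
    then show thesis using that[of 1] by (auto simp: C_def)
  next
    case False
    have "closed {(a, b). r \<le> norm (a - b :: real^'n)}"
      unfolding case_prod_beta by (intro closed_Collect_le continuous_intros)
    then have "compact C"
      unfolding C_def by (intro compact_Times compact_orthogonal_matrices compact_Int_closed K)
    moreover have "continuous_on C h"
    proof -
      have "continuous_on C (\<lambda>x. p (fst (snd x)) (snd (snd x)) i)" for i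
        unfolding p_def by (cases "snd i") (auto intro!: continuous_intros)
      then show ?thesis unfolding h_def case_prod_beta by (intro continuous_intros)
    qed
    ultimately obtain c where c: "c \<in> C" "\<And>x. x \<in> C \<Longrightarrow> h c \<le> h x"
      using continuous_attains_inf[OF _ False] by meson
    define \<delta> where "\<delta> = h c / card I"
    have h0: "h c > 0" using pos[of "fst c" "fst (snd c)" "snd (snd c)"] c by simp
    have card0: "card I > 0" using I by (simp add: card_gt_0_iff)
    show thesis
    proof (rule that)
      show "\<delta> > 0" using h0 card0 by (simp add: \<delta>_def)
      fix W :: "real^'n^'n" and a b
      assume "orthogonal_matrix W" "a \<in> K" "b \<in> K" "r \<le> norm (a - b)"
      then have "(W, a, b) \<in> C" by (simp add: C_def)
      then have le: "h c \<le> h (W, a, b)" by (rule c(2))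
      have "\<exists>ij\<in>I. eigen_defect T (W *v (p a b (fst ij) - p a b (snd ij))) \<ge> \<delta>"
      proof (rule ccontr)
        assume "\<not> ?thesis"
        then have "h (W, a, b) < of_nat (card I) * \<delta>"
          unfolding h_def using card0 by (auto intro!: sum_bounded_above_strict simp: not_le)
        then show False using le card0 by (simp add: \<delta>_def)
      qed
      then show "\<exists>U\<in>F. \<exists>V\<in>F. \<exists>x\<in>{a,b}. \<exists>y\<in>{a,b}.
          eigen_defect (transpose M ** M) (W *v (U *v x - V *v y)) \<ge> \<delta>"
        using range unfolding T_def by blast
    qed
  qed
qed

section \<open>Logarithmic and Gaussian energy\<close>

text \<open>On a set of diameter at most \<open>D\<close> the kernel shifted by \<open>ln D\<close> is nonnegative, so its integrals can be
  taken in \<open>ennreal\<close>.\<close>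

definition shifted_log_kernel :: "real \<Rightarrow> 'a::real_normed_vector \<Rightarrow> ennreal" where
  "shifted_log_kernel D z = (if z = 0 then \<infinity> else ennreal (ln (D / norm z)))"

definition shifted_log_energy :: "real \<Rightarrow> 'a::real_normed_vector measure \<Rightarrow> ennreal" where
  "shifted_log_energy D \<nu> = (\<integral>\<^sup>+y. \<integral>\<^sup>+x. shifted_log_kernel D (x - y) \<partial>\<nu> \<partial>\<nu>)"

text \<open>Measures on the whole space that are concentrated on \<open>K\<close>, instead of
  measures on the subspace: push-forwards and averages then keep the same sigma-algebra.\<close>

definition borel_probs_supported :: "'a::topological_space set \<Rightarrow> 'a measure set" where
  "borel_probs_supported K = {\<nu>. prob_space \<nu> \<and> sets \<nu> = sets borel \<and> (AE x in \<nu>. x \<in> K)}"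

lemma shifted_log_kernel_measurable [measurable]:
  "shifted_log_kernel D \<in> borel_measurable (borel :: 'a::euclidean_space measure)"
  unfolding shifted_log_kernel_def by measurable

lemma borel_measurable_convolution:
  fixes f :: "'a::euclidean_space \<Rightarrow> ennreal"
  assumes "prob_space \<nu>" and sets [measurable_cong]: "sets \<nu> = sets borel" and [measurable]: "f \<in> borel_measurable borel"
  shows "(\<lambda>y. \<integral>\<^sup>+x. f (x - y) \<partial>\<nu>) \<in> borel_measurable borel"
proof -
  interpret prob_space \<nu> by fact
  show ?thesis by (rule borel_measurable_nn_integral) measurable
qed

text \<open>With \<open>?p\<close> and \<open>?n\<close> the positive and negative parts of
  \<open>g - c\<close>, the identity \<open>?p + c = g + ?n\<close> is integrated in
  \<open>ennreal\<close>. As \<open>?n\<close> is at most \<open>c\<close>, its integral is finite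
  and may be subtracted.\<close>

lemma extended_integral_diff_const:
  assumes "prob_space \<mu>" and g [measurable]: "g \<in> borel_measurable \<mu>" and c: "c \<ge> 0"
    and f: "\<And>x. x \<in> space \<mu> \<Longrightarrow> f x = enn2ereal (g x) - ereal c"
  shows "extended_integral \<mu> f = enn2ereal (\<integral>\<^sup>+x. g x \<partial>\<mu>) - ereal c"
proof -
  interpret prob_space \<mu> by fact
  let ?p = "\<lambda>x. e2ennreal (enn2ereal (g x) - ereal c)" and ?n = "\<lambda>x. e2ennreal (- (enn2ereal (g x) - ereal c))"
  have "?p x + ennreal c = g x + ?n x" for x
  proof (cases "g x")
    case (real r)
    then show ?thesis using c
      by (cases "r \<le> c") (simp_all add: e2ennreal_ereal enn2ereal_ennreal ennreal_neg flip: ennreal_plus)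
  next
    case top
    then show ?thesis using c by (simp add: e2ennreal_infty)
  qed
  then have "(\<integral>\<^sup>+x. ?p x + ennreal c \<partial>\<mu>) = (\<integral>\<^sup>+x. g x + ?n x \<partial>\<mu>)" by simp
  then have eq: "(\<integral>\<^sup>+x. ?p x \<partial>\<mu>) + ennreal c = (\<integral>\<^sup>+x. g x \<partial>\<mu>) + (\<integral>\<^sup>+x. ?n x \<partial>\<mu>)"
    by (simp add: nn_integral_add emeasure_space_1)
  have "?n x \<le> ennreal c" for x
  proof (cases "g x")
    case (real r)
    then show ?thesis by (simp add: enn2ereal_ennreal e2ennreal_ereal ennreal_leI)
  qed (simp add: e2ennreal_neg)
  then have "(\<integral>\<^sup>+x. ?n x \<partial>\<mu>) \<le> (\<integral>\<^sup>+x. ennreal c \<partial>\<mu>)" by (intro nn_integral_mono)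
  then have "(\<integral>\<^sup>+x. ?n x \<partial>\<mu>) < top" by (simp add: emeasure_space_1 order_le_less_trans)
  then obtain n where n: "(\<integral>\<^sup>+x. ?n x \<partial>\<mu>) = ennreal n" "n \<ge> 0"
    by (cases "\<integral>\<^sup>+x. ?n x \<partial>\<mu>") auto
  have "extended_integral \<mu> f = enn2ereal (\<integral>\<^sup>+x. ?p x \<partial>\<mu>) - enn2ereal (\<integral>\<^sup>+x. ?n x \<partial>\<mu>)"
    unfolding extended_integral_def using f by (simp cong: nn_integral_cong)
  also have "\<dots> = enn2ereal (\<integral>\<^sup>+x. g x \<partial>\<mu>) - ereal c"
  proof (cases "\<integral>\<^sup>+x. g x \<partial>\<mu>")
    case top
    then have "(\<integral>\<^sup>+x. ?p x \<partial>\<mu>) = top" using eq by (cases "\<integral>\<^sup>+x. ?p x \<partial>\<mu>") (auto simp: n ennreal_plus[symmetric] simp del: ennreal_plus)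
    then show ?thesis using top n by (simp add: enn2ereal_ennreal)
  next
    case (real r)
    then obtain p where p: "(\<integral>\<^sup>+x. ?p x \<partial>\<mu>) = ennreal p" "p \<ge> 0"
      using eq n by (cases "\<integral>\<^sup>+x. ?p x \<partial>\<mu>") (auto simp: ennreal_plus[symmetric] simp del: ennreal_plus)
    then have "ennreal (p + c) = ennreal (r + n)" using eq real n c by (simp add: ennreal_plus)
    then have "p + c = r + n" using p c real n by (subst (asm) ennreal_inj) auto
    then show ?thesis using p n real by (simp add: enn2ereal_ennreal)
  qed
  finally show ?thesis .
qed

lemma log_kernel_eq_shifted:
  assumes "norm (x - y) \<le> D" "D \<ge> 1"
  shows "log_kernel x y = enn2ereal (shifted_log_kernel D (x - y)) - ereal (ln D)"
proof (cases "x = y")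
  case False
  then have "ln (D / norm (x - y)) \<ge> 0" using assms by (intro ln_ge_zero) simp
  then show ?thesis using False assms
    by (simp add: log_kernel_def shifted_log_kernel_def enn2ereal_ennreal ln_div)
qed (simp add: log_kernel_def shifted_log_kernel_def)

lemma log_energy_integral_eq_shifted:
  fixes K :: "'a::euclidean_space set"
  assumes \<mu>: "\<mu> \<in> borel_prob_measures_on K" and D: "D \<ge> 1" "\<And>x y. x \<in> K \<Longrightarrow> y \<in> K \<Longrightarrow> norm (x - y) \<le> D"
  shows "extended_integral \<mu> (\<lambda>y. extended_integral \<mu> (\<lambda>x. log_kernel x y))
    = enn2ereal (shifted_log_energy D (distr \<mu> borel (\<lambda>x. x))) - ereal (ln D)"
proof -
  have sets: "sets \<mu> = sets (restrict_space borel K)" and pr: "prob_space \<mu>"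
    using \<mu> by (auto simp: borel_prob_measures_on_def)
  interpret prob_space \<mu> by fact
  have space: "space \<mu> = K" using sets_eq_imp_space_eq[OF sets] by (simp add: space_restrict_space)
  have borel: "f \<in> borel_measurable \<mu>" if "f \<in> borel_measurable borel" for f :: "'a \<Rightarrow> ennreal"
    using measurable_restrict_space1[OF that, of K] measurable_cong_sets[OF sets refl] by blast
  have id [measurable]: "(\<lambda>x. x) \<in> \<mu> \<rightarrow>\<^sub>M borel"
    using measurable_restrict_space1[OF measurable_ident, of borel K] measurable_cong_sets[OF sets refl]
    unfolding id_def by blast
  let ?\<nu> = "distr \<mu> borel (\<lambda>x. x)"
  interpret \<nu>: prob_space ?\<nu> by (rule prob_space_distr) fact
  have meas [measurable]: "(\<lambda>y. \<integral>\<^sup>+x. shifted_log_kernel D (x - y) \<partial>?\<nu>) \<in> borel_measurable borel"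
    by (rule borel_measurable_convolution[OF \<nu>.prob_space_axioms sets_distr shifted_log_kernel_measurable])
  have "extended_integral \<mu> (\<lambda>x. log_kernel x y) =
      enn2ereal (\<integral>\<^sup>+x. shifted_log_kernel D (x - y) \<partial>\<mu>) - ereal (ln D)" if "y \<in> K" for y
    using that D by (intro extended_integral_diff_const pr borel log_kernel_eq_shifted) (auto simp: space)
  then have "extended_integral \<mu> (\<lambda>y. extended_integral \<mu> (\<lambda>x. log_kernel x y))
    = enn2ereal (\<integral>\<^sup>+y. (\<integral>\<^sup>+x. shifted_log_kernel D (x - y) \<partial>?\<nu>) \<partial>\<mu>) - ereal (ln D)"
    using D by (intro extended_integral_diff_const pr borel meas) (auto simp: space nn_integral_distr)
  also have "(\<integral>\<^sup>+y. (\<integral>\<^sup>+x. shifted_log_kernel D (x - y) \<partial>?\<nu>) \<partial>\<mu>) = shifted_log_energy D ?\<nu>"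
    unfolding shifted_log_energy_def by (subst (2) nn_integral_distr) (simp_all add: id meas)
  finally show ?thesis .
qed

text \<open>The two encodings of a probability measure on \<open>K\<close> correspond through
  \<open>distr\<close> along the identity and through \<open>restrict_space\<close>.
  \<open>D \<ge> 1\<close> makes the shift \<open>ln D\<close> nonnegative.\<close>

lemma log_energy_eq_shifted:
  fixes K :: "'a::euclidean_space set"
  assumes K: "compact K" and D: "D \<ge> 1" "\<And>x y. x \<in> K \<Longrightarrow> y \<in> K \<Longrightarrow> norm (x - y) \<le> D"
  shows "log_energy K = (INF \<nu>\<in>borel_probs_supported K. enn2ereal (shifted_log_energy D \<nu>) - ereal (ln D))"
  unfolding log_energy_def
proof (rule INF_eq)
  fix \<mu> assume \<mu>: "\<mu> \<in> borel_prob_measures_on K"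
  then have sets: "sets \<mu> = sets (restrict_space borel K)" and pr: "prob_space \<mu>"
    by (auto simp: borel_prob_measures_on_def)
  have space: "space \<mu> = K" using sets_eq_imp_space_eq[OF sets] by (simp add: space_restrict_space)
  have id: "(\<lambda>x. x) \<in> \<mu> \<rightarrow>\<^sub>M borel"
    using measurable_restrict_space1[OF measurable_ident, of borel K] measurable_cong_sets[OF sets refl]
    unfolding id_def by blast
  have "K \<in> sets borel" using K by (simp add: compact_imp_closed)
  then have "distr \<mu> borel (\<lambda>x. x) \<in> borel_probs_supported K"
    using prob_space.prob_space_distr[OF pr id] id
    by (auto simp: borel_probs_supported_def AE_distr_iff space[symmetric])
  then show "\<exists>\<nu>\<in>borel_probs_supported K. enn2ereal (shifted_log_energy D \<nu>) - ereal (ln D)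
      \<le> extended_integral \<mu> (\<lambda>y. extended_integral \<mu> (\<lambda>x. log_kernel x y))"
    using log_energy_integral_eq_shifted[OF \<mu> D] by (intro bexI) auto
next
  fix \<nu> :: "'a measure" assume "\<nu> \<in> borel_probs_supported K"
  then have pr: "prob_space \<nu>" and sets [measurable_cong]: "sets \<nu> = sets borel" and AE: "AE x in \<nu>. x \<in> K"
    by (auto simp: borel_probs_supported_def)
  have K' [measurable]: "K \<in> sets borel" using K by (simp add: compact_imp_closed)
  have space: "space \<nu> = UNIV" using sets_eq_imp_space_eq[OF sets] by simp
  let ?\<mu> = "restrict_space \<nu> K"
  have em: "emeasure ?\<mu> (A \<inter> K) = emeasure \<nu> A" if A [measurable]: "A \<in> sets borel" for A
  proof -
    have "emeasure ?\<mu> (A \<inter> K) = emeasure \<nu> (A \<inter> K)"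
      by (rule emeasure_restrict_space) (auto simp: sets space)
    also have "\<dots> = emeasure \<nu> A" using AE by (intro emeasure_eq_AE) auto
    finally show ?thesis .
  qed
  have "prob_space ?\<mu>"
    using em[of UNIV] prob_space.emeasure_space_1[OF pr] by (intro prob_spaceI) (simp add: space_restrict_space space)
  moreover have sets': "sets ?\<mu> = sets (restrict_space borel K)"
    by (simp add: sets_restrict_space sets)
  ultimately have \<mu>: "?\<mu> \<in> borel_prob_measures_on K" by (simp add: borel_prob_measures_on_def)
  have id: "(\<lambda>x. x) \<in> ?\<mu> \<rightarrow>\<^sub>M borel"
    using measurable_restrict_space1[OF measurable_ident, of borel K] measurable_cong_sets[OF sets' refl]
    unfolding id_def by blast
  have "distr ?\<mu> borel (\<lambda>x. x) = \<nu>"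
    using id by (intro measure_eqI) (auto simp: sets emeasure_distr space_restrict_space space em Int_commute)
  then show "\<exists>\<mu>\<in>borel_prob_measures_on K. extended_integral \<mu> (\<lambda>y. extended_integral \<mu> (\<lambda>x. log_kernel x y))
      \<le> enn2ereal (shifted_log_energy D \<nu>) - ereal (ln D)"
    using log_energy_integral_eq_shifted[OF \<mu> D] \<mu> by (intro bexI[of _ ?\<mu>]) simp_all
qed

section \<open>The logarithmic energy as a mixture of Gaussian energies\<close>

lemma nn_integral_exp_minus_Ioi:
  fixes s :: real
  assumes "s > 0"
  shows "(\<integral>\<^sup>+t. indicator {0<..} t * ennreal (exp (- t * s)) \<partial>lborel) = ennreal (1 / s)"
proof -
  have "filterlim (\<lambda>t. - t * s) at_bot at_top"
    using filterlim_tendsto_pos_mult_at_top[OF tendsto_const assms filterlim_ident]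
    by (simp add: filterlim_uminus_at_bot mult.commute)
  then have "((\<lambda>t. exp (- t * s)) \<longlongrightarrow> 0) at_top" by (rule filterlim_compose[OF exp_at_bot])
  then have lim: "((\<lambda>t. - exp (- t * s) / s) \<longlongrightarrow> - 0 / s) at_top"
    using assms by (intro tendsto_intros) auto
  have "(\<integral>\<^sup>+t. ennreal (exp (- t * s)) * indicator {0..} t \<partial>lborel) = ennreal (- 0 / s - (- exp (- 0 * s) / s))"
    using assms by (intro nn_integral_FTC_atLeast lim) (auto intro!: derivative_eq_intros)
  moreover have "(\<integral>\<^sup>+t. indicator {0<..} t * ennreal (exp (- t * s)) \<partial>lborel)
      = (\<integral>\<^sup>+t. ennreal (exp (- t * s)) * indicator {0..} t \<partial>lborel)"
    using AE_lborel_singleton[of "0::real"]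
    by (intro nn_integral_cong_AE) (auto elim!: eventually_mono split: split_indicator)
  ultimately show ?thesis by simp
qed

lemma nn_integral_exp_minus_Icc:
  fixes a b t :: real
  assumes "t > 0" "a \<le> b"
  shows "(\<integral>\<^sup>+s. indicator {a..b} s * ennreal (exp (- t * s)) \<partial>lborel) = ennreal ((exp (- t * a) - exp (- t * b)) / t)"
proof -
  have "(\<integral>\<^sup>+s. ennreal (exp (- t * s)) * indicator {a..b} s \<partial>lborel)
      = ennreal (- exp (- t * b) / t - (- exp (- t * a) / t))"
    using assms by (intro nn_integral_FTC_Icc) (auto intro!: derivative_eq_intros)
  then show ?thesis by (simp add: diff_divide_distrib mult.commute)
qed

lemma nn_integral_inverse_Icc:
  fixes a b :: real
  assumes "0 < a" "a \<le> b"
  shows "(\<integral>\<^sup>+s. indicator {a..b} s * ennreal (1 / s) \<partial>lborel) = ennreal (ln (b / a))"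
proof -
  have "(\<integral>\<^sup>+s. ennreal (1 / s) * indicator {a..b} s \<partial>lborel) = ennreal (ln b - ln a)"
    using assms by (intro nn_integral_FTC_Icc) (auto intro!: derivative_eq_intros simp: field_simps)
  then show ?thesis using assms by (simp add: ln_div mult.commute)
qed

lemma nn_integral_inverse_Icc_0:
  fixes b :: real
  assumes "0 < b"
  shows "(\<integral>\<^sup>+s. indicator {0..b} s * ennreal (1 / s) \<partial>lborel) = top"
proof (rule ccontr)
  let ?I = "\<integral>\<^sup>+s. indicator {0..b} s * ennreal (1 / s) \<partial>lborel"
  assume "?I \<noteq> top"
  then obtain r where r: "?I = ennreal r" "r \<ge> 0" by (cases ?I) auto
  \<comment> \<open>The integral over [a, b] alone is then r + 1, exceeding the supposed total
    \<open>r\<close>.\<close>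
  define a where "a = b / exp (r + 1)"
  have a: "0 < a" "a \<le> b" using assms r by (auto simp: a_def divide_le_eq)
  have "ennreal (ln (b / a)) = (\<integral>\<^sup>+s. indicator {a..b} s * ennreal (1 / s) \<partial>lborel)"
    using a by (simp add: nn_integral_inverse_Icc)
  also have "\<dots> \<le> ?I" using a by (intro nn_integral_mono) (auto split: split_indicator)
  also have "\<dots> = ennreal r" by (rule r)
  finally have "ln (b / a) \<le> r" using r by (simp add: ennreal_le_iff)
  moreover have "ln (b / a) = r + 1" using assms by (simp add: a_def)
  ultimately show False by simp
qed

text \<open>Frullani's integral, in a form that covers the singularity of the kernel at the origin.\<close>

lemma shifted_log_kernel_frullani:
  fixes z :: "'a::real_normed_vector"
  assumes "norm z \<le> D" "D > 0"
  shows "2 * shifted_log_kernel D z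
    = (\<integral>\<^sup>+t. indicator {0<..} t * ennreal ((exp (- t * (norm z)\<^sup>2) - exp (- t * D\<^sup>2)) / t) \<partial>lborel)"
proof -
  have le: "(norm z)\<^sup>2 \<le> D\<^sup>2" using assms by (intro power_mono) auto
  \<comment> \<open>Both sides are infinite at \<open>z = 0\<close>. Next, 1/s is written as the
    integral of exp(-t s) over t > 0, and the two integrals are exchanged.\<close>
  have "2 * shifted_log_kernel D z = (\<integral>\<^sup>+s. indicator {(norm z)\<^sup>2..D\<^sup>2} s * ennreal (1 / s) \<partial>lborel)"
  proof (cases "z = 0")
    case True
    then show ?thesis
      using nn_integral_inverse_Icc_0[of "D\<^sup>2"] assms
      by (simp add: shifted_log_kernel_def ennreal_mult_top)
  next
    case False
    have "ln (D\<^sup>2 / (norm z)\<^sup>2) = 2 * ln (D / norm z)"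
      using False assms by (simp add: ln_div ln_realpow)
    then have "ennreal (ln (D\<^sup>2 / (norm z)\<^sup>2)) = 2 * ennreal (ln (D / norm z))"
      by (simp only: ennreal_mult'[of 2] ennreal_numeral zero_le_numeral)
    then show ?thesis
      using False le nn_integral_inverse_Icc[of "(norm z)\<^sup>2" "D\<^sup>2"] by (simp add: shifted_log_kernel_def)
  qed
  also have "\<dots> = (\<integral>\<^sup>+s. (\<integral>\<^sup>+t. indicator {(norm z)\<^sup>2..D\<^sup>2} s * (indicator {0<..} t * ennreal (exp (- t * s))) \<partial>lborel) \<partial>lborel)"
  proof (rule nn_integral_cong_AE, use AE_lborel_singleton[of "0::real"] in eventually_elim)
    case (elim s)
    have "s > 0" if "s \<in> {(norm z)\<^sup>2..D\<^sup>2}"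
      using that elim order_trans[OF zero_le_power2[of "norm z"], of s] by auto
    then show ?case
      using nn_integral_exp_minus_Ioi[of s] by (simp add: nn_integral_cmult split: split_indicator)
  qed
  also have "\<dots> = (\<integral>\<^sup>+t. (\<integral>\<^sup>+s. indicator {(norm z)\<^sup>2..D\<^sup>2} s * (indicator {0<..} t * ennreal (exp (- t * s))) \<partial>lborel) \<partial>lborel)"
    by (rule lborel_pair.Fubini') measurable
  also have "\<dots> = (\<integral>\<^sup>+t. indicator {0<..} t * ennreal ((exp (- t * (norm z)\<^sup>2) - exp (- t * D\<^sup>2)) / t) \<partial>lborel)"
  proof (rule nn_integral_cong)
    fix t :: real
    show "(\<integral>\<^sup>+s. indicator {(norm z)\<^sup>2..D\<^sup>2} s * (indicator {0<..} t * ennreal (exp (- t * s))) \<partial>lborel)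
      = indicator {0<..} t * ennreal ((exp (- t * (norm z)\<^sup>2) - exp (- t * D\<^sup>2)) / t)"
      using nn_integral_exp_minus_Icc[OF _ le, of t] by (cases "t > 0") simp_all
  qed
  finally show ?thesis .
qed

definition gaussian_energy :: "real \<Rightarrow> 'a::real_normed_vector measure \<Rightarrow> ennreal" where
  "gaussian_energy t \<nu> = (\<integral>\<^sup>+y. \<integral>\<^sup>+x. ennreal (exp (- t * (norm (x - y))\<^sup>2)) \<partial>\<nu> \<partial>\<nu>)"

text \<open>Frullani's formula integrated over both variables. The measure and the energy enter the
  right-hand side only through \<open>gaussian_energy\<close>, and monotonically, so inequalities
  between Gaussian energies for all t > 0 pass to the logarithmic energy.\<close>

lemma shifted_log_energy_gaussian:
  fixes \<nu> :: "'a::euclidean_space measure"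
  assumes \<nu>: "\<nu> \<in> borel_probs_supported K" and D: "D > 0" "\<And>x y. x \<in> K \<Longrightarrow> y \<in> K \<Longrightarrow> norm (x - y) \<le> D"
  shows "2 * shifted_log_energy D \<nu>
    = (\<integral>\<^sup>+t. indicator {0<..} t * (ennreal (1 / t) * (gaussian_energy t \<nu> - ennreal (exp (- t * D\<^sup>2)))) \<partial>lborel)"
proof -
  have pr: "prob_space \<nu>" and sets [measurable_cong]: "sets \<nu> = sets borel" and AE: "AE x in \<nu>. x \<in> K"
    using \<nu> by (auto simp: borel_probs_supported_def)
  interpret prob_space \<nu> by fact
  interpret pair_sigma_finite \<nu> lborel ..
  let ?f = "\<lambda>t x y. indicator {0<..} t * ennreal ((exp (- t * (norm (x - y :: 'a))\<^sup>2) - exp (- t * D\<^sup>2)) / t)"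
  have "2 * shifted_log_energy D \<nu> = (\<integral>\<^sup>+y. \<integral>\<^sup>+x. 2 * shifted_log_kernel D (x - y) \<partial>\<nu> \<partial>\<nu>)"
    unfolding shifted_log_energy_def by (simp add: nn_integral_cmult)
  also have "\<dots> = (\<integral>\<^sup>+y. \<integral>\<^sup>+x. \<integral>\<^sup>+t. ?f t x y \<partial>lborel \<partial>\<nu> \<partial>\<nu>)"
  proof (rule nn_integral_cong_AE, use AE in eventually_elim)
    case (elim y)
    show ?case
    proof (rule nn_integral_cong_AE, use AE in eventually_elim)
      case (elim x)
      then show ?case using \<open>y \<in> K\<close> D by (intro shifted_log_kernel_frullani) auto
    qed
  qed
  also have "\<dots> = (\<integral>\<^sup>+y. \<integral>\<^sup>+t. \<integral>\<^sup>+x. ?f t x y \<partial>\<nu> \<partial>lborel \<partial>\<nu>)"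
    by (intro nn_integral_cong Fubini'[symmetric]) measurable
  also have "\<dots> = (\<integral>\<^sup>+t. \<integral>\<^sup>+y. \<integral>\<^sup>+x. ?f t x y \<partial>\<nu> \<partial>\<nu> \<partial>lborel)"
    by (intro Fubini'[symmetric]) measurable
  also have "\<dots> = (\<integral>\<^sup>+t. indicator {0<..} t * (ennreal (1 / t) * (gaussian_energy t \<nu> - ennreal (exp (- t * D\<^sup>2)))) \<partial>lborel)"
  proof (rule nn_integral_cong)
    fix t :: real
    let ?c = "exp (- t * D\<^sup>2)"
    show "(\<integral>\<^sup>+y. \<integral>\<^sup>+x. ?f t x y \<partial>\<nu> \<partial>\<nu>) = indicator {0<..} t * (ennreal (1 / t) * (gaussian_energy t \<nu> - ennreal ?c))"
    proof (cases "t > 0")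
      case True
      let ?g = "\<lambda>x y :: 'a. ennreal (exp (- t * (norm (x - y))\<^sup>2) - ?c)"
      have "(\<integral>\<^sup>+y. \<integral>\<^sup>+x. ?f t x y \<partial>\<nu> \<partial>\<nu>) = (\<integral>\<^sup>+y. \<integral>\<^sup>+x. ennreal (1 / t) * ?g x y \<partial>\<nu> \<partial>\<nu>)"
        using True by (simp add: ennreal_mult'[symmetric])
      also have "\<dots> = ennreal (1 / t) * (\<integral>\<^sup>+y. \<integral>\<^sup>+x. ?g x y \<partial>\<nu> \<partial>\<nu>)"
        by (simp add: nn_integral_cmult)
      also have "(\<integral>\<^sup>+y. \<integral>\<^sup>+x. ?g x y \<partial>\<nu> \<partial>\<nu>) = gaussian_energy t \<nu> - ennreal ?c"
      proof -
        have "gaussian_energy t \<nu> = (\<integral>\<^sup>+y. \<integral>\<^sup>+x. ?g x y + ennreal ?c \<partial>\<nu> \<partial>\<nu>)"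
          unfolding gaussian_energy_def
        proof (rule nn_integral_cong_AE, use AE in eventually_elim)
          case (elim y)
          show ?case
          proof (rule nn_integral_cong_AE, use AE in eventually_elim)
            case (elim x)
            have "(norm (x - y))\<^sup>2 \<le> D\<^sup>2" using elim \<open>y \<in> K\<close> D by (intro power_mono) auto
            \<comment> \<open>Hence the truncated subtraction inside \<open>?g\<close> loses
              nothing.\<close>
            then have "?c \<le> exp (- t * (norm (x - y))\<^sup>2)" using True by simp
            then show ?case by (simp flip: ennreal_plus)
          qed
        qed
        also have "\<dots> = (\<integral>\<^sup>+y. \<integral>\<^sup>+x. ?g x y \<partial>\<nu> \<partial>\<nu>) + ennreal ?c"
          by (simp add: nn_integral_add emeasure_space_1)
        finally show ?thesis by simp
      qed
      finally show ?thesis using True by simp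
    qed simp
  qed
  finally show ?thesis .
qed

lemma nn_integral_gaussian_real:
  assumes "a > 0"
  shows "(\<integral>\<^sup>+u. ennreal (exp (- a * u\<^sup>2)) \<partial>lborel) = ennreal (sqrt (pi / a))"
proof -
  define \<sigma> where "\<sigma> = sqrt (1 / (2 * a))"
  have \<sigma>: "\<sigma>\<^sup>2 = 1 / (2 * a)" "\<sigma> > 0" using assms by (auto simp: \<sigma>_def)
  have "ennreal (exp (- a * u\<^sup>2)) = ennreal (sqrt (pi / a)) * ennreal (normal_density 0 \<sigma> u)" for u
    using assms by (simp add: normal_density_def \<sigma> ennreal_mult[symmetric] real_sqrt_divide field_simps)
  moreover have "(\<integral>\<^sup>+u. ennreal (normal_density 0 \<sigma> u) \<partial>lborel) = 1"
    using prob_space.emeasure_space_1[OF prob_space_normal_density[OF \<sigma>(2), of 0]]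
    by (simp add: emeasure_density)
  ultimately show ?thesis by (simp add: nn_integral_cmult)
qed

lemma nn_integral_gaussian:
  assumes "a > 0"
  shows "(\<integral>\<^sup>+w. ennreal (exp (- a * (norm w)\<^sup>2)) \<partial>(lborel :: 'a::euclidean_space measure))
    = ennreal (sqrt (pi / a) ^ DIM('a))"
proof -
  have "ennreal (exp (- a * (norm w)\<^sup>2)) = (\<Prod>b\<in>Basis. ennreal (exp (- a * (w \<bullet> b)\<^sup>2)))" for w :: 'a
    by (subst euclidean_inner[of w w, folded power2_norm_eq_inner])
      (simp add: prod_ennreal exp_sum[symmetric] sum_distrib_left power2_eq_square sum_negf)
  then have "(\<integral>\<^sup>+w. ennreal (exp (- a * (norm w)\<^sup>2)) \<partial>(lborel :: 'a measure))
    = (\<Prod>b\<in>(Basis :: 'a set). ennreal (sqrt (pi / a)))"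
    using assms nn_integral_lborel_prod[where 'a='a and f = "\<lambda>_ u. ennreal (exp (- a * u\<^sup>2))"]
      nn_integral_gaussian_real[OF assms]
    by simp
  also have "\<dots> = ennreal (sqrt (pi / a) ^ DIM('a))" using assms by (simp add: ennreal_power)
  finally show ?thesis .
qed

text \<open>The parallelogram law about the midpoint \<open>c\<close> of \<open>x\<close> and
  \<open>y\<close> separates the two factors, leaving a full Gaussian integral with exponent 4t in w
  - c.\<close>

lemma gaussian_convolution:
  fixes x y :: "'a::euclidean_space"
  assumes "t > 0"
  shows "(\<integral>\<^sup>+w. ennreal (exp (- (2 * t) * (norm (x - w))\<^sup>2)) * ennreal (exp (- (2 * t) * (norm (y - w))\<^sup>2)) \<partial>lborel)
    = ennreal (sqrt (pi / (4 * t)) ^ DIM('a)) * ennreal (exp (- t * (norm (x - y))\<^sup>2))"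
proof -
  define c where "c = (1 / 2) *\<^sub>R (x + y)"
  have eq: "2 * (norm (x - w))\<^sup>2 + 2 * (norm (y - w))\<^sup>2 = (norm (x - y))\<^sup>2 + 4 * (norm (w - c))\<^sup>2" for w
    unfolding c_def power2_norm_eq_inner by (simp add: inner_simps inner_commute algebra_simps)
  have "(\<integral>\<^sup>+w. ennreal (exp (- (2 * t) * (norm (x - w))\<^sup>2)) * ennreal (exp (- (2 * t) * (norm (y - w))\<^sup>2)) \<partial>lborel)
    = (\<integral>\<^sup>+w. ennreal (exp (- t * (norm (x - y))\<^sup>2)) * ennreal (exp (- (4 * t) * (norm (w - c))\<^sup>2)) \<partial>lborel)"
  proof (rule nn_integral_cong)
    fix w :: 'a
    have "- (2 * t) * (norm (x - w))\<^sup>2 + - (2 * t) * (norm (y - w))\<^sup>2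
        = - t * (2 * (norm (x - w))\<^sup>2 + 2 * (norm (y - w))\<^sup>2)" by (simp add: algebra_simps)
    also have "\<dots> = - t * (norm (x - y))\<^sup>2 + - (4 * t) * (norm (w - c))\<^sup>2"
      unfolding eq by (simp add: algebra_simps)
    finally show "ennreal (exp (- (2 * t) * (norm (x - w))\<^sup>2)) * ennreal (exp (- (2 * t) * (norm (y - w))\<^sup>2))
      = ennreal (exp (- t * (norm (x - y))\<^sup>2)) * ennreal (exp (- (4 * t) * (norm (w - c))\<^sup>2))"
      by (simp only: ennreal_mult[symmetric] exp_ge_zero exp_add[symmetric])
  qed
  also have "\<dots> = ennreal (exp (- t * (norm (x - y))\<^sup>2)) * (\<integral>\<^sup>+w. ennreal (exp (- (4 * t) * (norm (w - c))\<^sup>2)) \<partial>lborel)"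
    by (rule nn_integral_cmult) measurable
  also have "(\<integral>\<^sup>+w. ennreal (exp (- (4 * t) * (norm (w - c))\<^sup>2)) \<partial>lborel)
      = (\<integral>\<^sup>+w. ennreal (exp (- (4 * t) * (norm (w - c))\<^sup>2)) \<partial>distr lborel borel ((+) c))"
    by (simp add: lborel_distr_plus)
  also have "\<dots> = (\<integral>\<^sup>+w. ennreal (exp (- (4 * t) * (norm w)\<^sup>2)) \<partial>(lborel :: 'a measure))"
    by (subst nn_integral_distr) auto
  also have "\<dots> = ennreal (sqrt (pi / (4 * t)) ^ DIM('a))"
    using assms by (intro nn_integral_gaussian) simp
  finally show ?thesis by (simp add: mult.commute)
qed

text \<open>Up to a constant, the Gaussian energy is the squared L2 norm of a potential that is
  linear in the measure. This is the positive definiteness, and it makes the energy convex.\<close>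

lemma gaussian_energy_eq_square:
  fixes \<nu> :: "'a::euclidean_space measure"
  assumes pr: "prob_space \<nu>" and sets [measurable_cong]: "sets \<nu> = sets borel" and t: "t > 0"
  shows "ennreal (sqrt (pi / (4 * t)) ^ DIM('a)) * gaussian_energy t \<nu>
    = (\<integral>\<^sup>+w. (\<integral>\<^sup>+x. ennreal (exp (- (2 * t) * (norm (x - w))\<^sup>2)) \<partial>\<nu>)\<^sup>2 \<partial>lborel)"
proof -
  interpret prob_space \<nu> by fact
  interpret pair_sigma_finite \<nu> lborel ..
  let ?e = "\<lambda>x w :: 'a. ennreal (exp (- (2 * t) * (norm (x - w))\<^sup>2))"
  have "ennreal (sqrt (pi / (4 * t)) ^ DIM('a)) * gaussian_energy t \<nu>
      = (\<integral>\<^sup>+y. \<integral>\<^sup>+x. ennreal (sqrt (pi / (4 * t)) ^ DIM('a)) * ennreal (exp (- t * (norm (x - y))\<^sup>2)) \<partial>\<nu> \<partial>\<nu>)"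
    unfolding gaussian_energy_def by (simp add: nn_integral_cmult)
  also have "\<dots> = (\<integral>\<^sup>+y. \<integral>\<^sup>+x. \<integral>\<^sup>+w. ?e x w * ?e y w \<partial>lborel \<partial>\<nu> \<partial>\<nu>)"
    using t by (simp only: gaussian_convolution)
  also have "\<dots> = (\<integral>\<^sup>+y. \<integral>\<^sup>+w. \<integral>\<^sup>+x. ?e x w * ?e y w \<partial>\<nu> \<partial>lborel \<partial>\<nu>)"
    by (intro nn_integral_cong Fubini'[symmetric]) measurable
  also have "\<dots> = (\<integral>\<^sup>+w. \<integral>\<^sup>+y. \<integral>\<^sup>+x. ?e x w * ?e y w \<partial>\<nu> \<partial>\<nu> \<partial>lborel)"
    by (intro Fubini'[symmetric]) measurable
  also have "\<dots> = (\<integral>\<^sup>+w. (\<integral>\<^sup>+x. ?e x w \<partial>\<nu>)\<^sup>2 \<partial>lborel)"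
    by (simp add: nn_integral_multc nn_integral_cmult power2_eq_square)
  finally show ?thesis .
qed

section \<open>Push-forwards and averages over isometries\<close>

lemma borel_probs_supportedD:
  assumes "\<nu> \<in> borel_probs_supported K"
  shows "prob_space \<nu>" "sets \<nu> = sets borel" "AE x in \<nu>. x \<in> K"
  using assms by (auto simp: borel_probs_supported_def)

lemma matrix_vector_mult_measurable [measurable]:
  fixes A :: "real^'n^'m"
  shows "(\<lambda>x. A *v x) \<in> borel_measurable borel"
  by (intro borel_measurable_continuous_onI continuous_intros)

lemma borel_probs_supported_linear_image:
  fixes A :: "real^'n^'n"
  assumes "\<nu> \<in> borel_probs_supported K" "compact K"
  shows "distr \<nu> borel ((*v) A) \<in> borel_probs_supported (linear_image A K)"
proof -
  note \<nu> = borel_probs_supportedD[OF assms(1)]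
  have m: "(*v) A \<in> \<nu> \<rightarrow>\<^sub>M borel"
    using matrix_vector_mult_measurable[of A] measurable_cong_sets[OF \<nu>(2) refl] by blast
  have "compact (linear_image A K)"
    unfolding linear_image_def using assms(2) by (intro compact_continuous_image continuous_intros)
  then have "linear_image A K \<in> sets borel" by (simp add: compact_imp_closed)
  then have "AE x in distr \<nu> borel ((*v) A). x \<in> linear_image A K"
    using \<nu>(3) by (subst AE_distr_iff[OF m]) (auto simp: linear_image_def elim!: eventually_mono)
  then show ?thesis
    using prob_space.prob_space_distr[OF \<nu>(1) m] by (simp add: borel_probs_supported_def)
qed

lemma shifted_log_energy_distr:
  fixes A :: "real^'n^'n"
  assumes \<nu>: "prob_space \<nu>" "sets \<nu> = sets borel"
  shows "shifted_log_energy D (distr \<nu> borel ((*v) A))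
    = (\<integral>\<^sup>+y. \<integral>\<^sup>+x. shifted_log_kernel D (A *v (x - y)) \<partial>\<nu> \<partial>\<nu>)"
proof -
  have m [measurable]: "(*v) A \<in> \<nu> \<rightarrow>\<^sub>M borel"
    using matrix_vector_mult_measurable[of A] measurable_cong_sets[OF \<nu>(2) refl] by blast
  interpret p: prob_space "distr \<nu> borel ((*v) A)" by (rule prob_space.prob_space_distr[OF \<nu>(1) m])
  have [measurable]: "(\<lambda>y. \<integral>\<^sup>+x. shifted_log_kernel D (x - y) \<partial>distr \<nu> borel ((*v) A)) \<in> borel_measurable borel"
    by (rule borel_measurable_convolution[OF p.prob_space_axioms sets_distr shifted_log_kernel_measurable])
  have "shifted_log_energy D (distr \<nu> borel ((*v) A)) =
      (\<integral>\<^sup>+y. (\<integral>\<^sup>+x. shifted_log_kernel D (x - A *v y) \<partial>distr \<nu> borel ((*v) A)) \<partial>\<nu>)"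
    unfolding shifted_log_energy_def by (rule nn_integral_distr) measurable
  also have "\<dots> = (\<integral>\<^sup>+y. \<integral>\<^sup>+x. shifted_log_kernel D (A *v x - A *v y) \<partial>\<nu> \<partial>\<nu>)"
    by (intro nn_integral_cong nn_integral_distr) measurable
  finally show ?thesis by (simp add: matrix_vector_mult_diff_distrib)
qed

text \<open>The average of the push-forwards is the law of \<open>U x\<close> with \<open>U\<close>
  uniform in \<open>F\<close> and \<open>x\<close> distributed by \<open>\<mu>\<close>
  independently: a monadic bind over the uniform distribution on \<open>F\<close>.\<close>

lemma exists_orthogonal_mixture:
  fixes F :: "(real^'n^'n) set"
  assumes F: "finite F" "F \<noteq> {}" and iso: "\<And>U. U \<in> F \<Longrightarrow> linear_image U K = K"
    and K: "compact K" and \<mu>: "\<mu> \<in> borel_probs_supported K"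
  obtains \<nu> where "\<nu> \<in> borel_probs_supported K"
    "\<And>f. f \<in> borel_measurable borel \<Longrightarrow>
      (\<integral>\<^sup>+x. f x \<partial>\<nu>) = (\<Sum>U\<in>F. \<integral>\<^sup>+x. f (U *v x) \<partial>\<mu>) / ennreal (card F)"
proof -
  note mu = borel_probs_supportedD[OF \<mu>]
  have m [measurable]: "(*v) A \<in> \<mu> \<rightarrow>\<^sub>M borel" for A :: "real^'n^'n"
    using matrix_vector_mult_measurable[of A] measurable_cong_sets[OF mu(2) refl] by blast
  have pr: "prob_space (distr \<mu> borel ((*v) A))" for A :: "real^'n^'n"
    by (rule prob_space.prob_space_distr[OF mu(1) m])
  define N where "N = (\<lambda>U :: real^'n^'n. distr \<mu> borel ((*v) U))"
  define \<nu> where "\<nu> = measure_pmf (pmf_of_set F) \<bind> N"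
  have N: "N \<in> measurable (measure_pmf (pmf_of_set F)) (subprob_algebra borel)"
    using pr by (auto simp: N_def space_subprob_algebra intro!: prob_space_imp_subprob_space)
  have int: "(\<integral>\<^sup>+x. f x \<partial>\<nu>) = (\<Sum>U\<in>F. \<integral>\<^sup>+x. f (U *v x) \<partial>\<mu>) / ennreal (card F)"
    if [measurable]: "f \<in> borel_measurable borel" for f
    unfolding \<nu>_def using F
    by (subst nn_integral_bind[OF that N])
      (simp add: nn_integral_pmf_of_set N_def nn_integral_distr ennreal_of_nat_eq_real_of_nat)
  have sets: "sets \<nu> = sets borel" unfolding \<nu>_def by (rule sets_bind) (auto simp: N_def)
  have "prob_space \<nu>"
    unfolding \<nu>_def using pr N
    by (intro measure_pmf.prob_space_bind[where S=borel]) (auto simp: N_def)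
  moreover have "AE x in \<nu>. x \<in> K"
  proof -
    have [measurable]: "K \<in> sets borel" using K by (simp add: compact_imp_closed)
    have "(\<integral>\<^sup>+x. indicator (- K) x \<partial>\<nu>) = (\<Sum>U\<in>F. \<integral>\<^sup>+x. indicator (- K) (U *v x) \<partial>\<mu>) / ennreal (card F)"
      by (rule int) measurable
    also have "\<dots> = 0"
    proof -
      have "(\<integral>\<^sup>+x. indicator (- K) (U *v x) \<partial>\<mu>) = (\<integral>\<^sup>+x. 0 \<partial>\<mu>)" if "U \<in> F" for U
      proof (rule nn_integral_cong_AE, use mu(3) in eventually_elim)
        case (elim x)
        then have "U *v x \<in> K" using iso[OF that] by (auto simp: linear_image_def)
        then show ?case by simp
      qed
      then show ?thesis by simp
    qed
    finally have "emeasure \<nu> (- K) = 0" by (simp add: sets nn_integral_indicator)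
    then show ?thesis by (intro AE_I[of _ _ "- K"]) (auto simp: sets)
  qed
  ultimately have "\<nu> \<in> borel_probs_supported K" using sets by (simp add: borel_probs_supported_def)
  then show thesis using that int by blast
qed

lemma square_mean_le_mean_square_ennreal:
  fixes g :: "'i \<Rightarrow> ennreal"
  assumes "finite F" "F \<noteq> {}" "\<And>i. i \<in> F \<Longrightarrow> g i < top"
  shows "((\<Sum>i\<in>F. g i) / ennreal (card F))\<^sup>2 \<le> (\<Sum>i\<in>F. (g i)\<^sup>2) / ennreal (card F)"
proof -
  define h where "h = (\<lambda>i. enn2real (g i))"
  have g: "g i = ennreal (h i)" "h i \<ge> 0" if "i \<in> F" for i
    using assms(3)[OF that] by (auto simp: h_def)
  have c: "real (card F) > 0" using assms by (simp add: card_gt_0_iff)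
  have "((\<Sum>i\<in>F. h i) / card F)\<^sup>2 \<le> (\<Sum>i\<in>F. (h i)\<^sup>2) / card F"
    using sum_squared_le_sum_of_squares[of h F] assms c by (simp add: field_simps power2_eq_square)
  moreover have "(\<Sum>i\<in>F. g i) / ennreal (card F) = ennreal ((\<Sum>i\<in>F. h i) / card F)"
    using g c by (simp add: divide_ennreal sum_nonneg)
  moreover have "(\<Sum>i\<in>F. (g i)\<^sup>2) / ennreal (card F) = ennreal ((\<Sum>i\<in>F. (h i)\<^sup>2) / card F)"
    using g c by (simp add: divide_ennreal sum_nonneg ennreal_power)
  ultimately show ?thesis
    using c g by (simp add: ennreal_power sum_nonneg ennreal_leI)
qed

text \<open>Positive definiteness of the logarithmic kernel, inherited from that of the Gaussians, makes
  averaging over isometries decrease the energy.\<close>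

lemma shifted_log_energy_mixture_le:
  fixes F :: "(real^'n^'n) set"
  assumes F: "finite F" "F \<noteq> {}" and orth: "\<And>U. U \<in> F \<Longrightarrow> orthogonal_matrix U"
    and D: "D > 0" "\<And>x y. x \<in> K \<Longrightarrow> y \<in> K \<Longrightarrow> norm (x - y) \<le> D"
    and \<mu>: "\<mu> \<in> borel_probs_supported K" and \<nu>: "\<nu> \<in> borel_probs_supported K"
    and mix: "\<And>f. f \<in> borel_measurable borel \<Longrightarrow>
      (\<integral>\<^sup>+x. f x \<partial>\<nu>) = (\<Sum>U\<in>F. \<integral>\<^sup>+x. f (U *v x) \<partial>\<mu>) / ennreal (card F)"
  shows "shifted_log_energy D \<nu> \<le> shifted_log_energy D \<mu>"
proof -
  note mu = borel_probs_supportedD[OF \<mu>] and nu = borel_probs_supportedD[OF \<nu>]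
  interpret \<mu>: prob_space \<mu> by (rule mu)
  have [measurable_cong]: "sets \<mu> = sets borel" by (rule mu)
  have m [measurable]: "(*v) A \<in> \<mu> \<rightarrow>\<^sub>M borel" for A :: "real^'n^'n"
    using matrix_vector_mult_measurable[of A] measurable_cong_sets[OF mu(2) refl] by blast
  have gauss: "gaussian_energy t \<nu> \<le> gaussian_energy t \<mu>" if t: "t > 0" for t
  proof -
    let ?C = "ennreal (sqrt (pi / (4 * t)) ^ DIM(real^'n))"
    let ?e = "\<lambda>x w :: real^'n. ennreal (exp (- (2 * t) * (norm (x - w))\<^sup>2))"
    define g where "g = (\<lambda>U w. \<integral>\<^sup>+x. ?e (U *v x) w \<partial>\<mu>)"
    have gm [measurable]: "g U \<in> borel_measurable borel" for U
      unfolding g_def by (intro \<mu>.borel_measurable_nn_integral) measurable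
    have "g U w \<le> (\<integral>\<^sup>+x. 1 \<partial>\<mu>)" for U w
      unfolding g_def using t by (intro nn_integral_mono) simp
    then have gfin: "g U w < top" for U w
      by (simp add: \<mu>.emeasure_space_1 order_le_less_trans[of _ 1])
    have gU: "(\<integral>\<^sup>+w. (g U w)\<^sup>2 \<partial>lborel) = ?C * gaussian_energy t \<mu>" if "U \<in> F" for U
    proof -
      let ?\<mu> = "distr \<mu> borel ((*v) U)"
      have pr: "prob_space ?\<mu>" by (rule \<mu>.prob_space_distr) measurable
      have "g U w = (\<integral>\<^sup>+x. ?e x w \<partial>?\<mu>)" for w unfolding g_def by (subst nn_integral_distr) auto
      then have "(\<integral>\<^sup>+w. (g U w)\<^sup>2 \<partial>lborel) = ?C * gaussian_energy t ?\<mu>"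
        using gaussian_energy_eq_square[OF pr sets_distr t] by simp
      moreover have "gaussian_energy t ?\<mu> = gaussian_energy t \<mu>"
      proof -
        have [measurable]: "(\<lambda>y. \<integral>\<^sup>+x. ennreal (exp (- t * (norm (x - y))\<^sup>2)) \<partial>?\<mu>) \<in> borel_measurable borel"
          by (rule borel_measurable_convolution[OF pr sets_distr, where f = "\<lambda>z. ennreal (exp (- t * (norm z)\<^sup>2))"]) measurable
        show ?thesis unfolding gaussian_energy_def
          by (subst nn_integral_distr) (auto intro!: nn_integral_cong
              simp: nn_integral_distr norm_orthogonal_matrix_vector[OF orth[OF that]]
              simp flip: matrix_vector_mult_diff_distrib)
      qed
      ultimately show ?thesis by simp
    qed
    have "?C * gaussian_energy t \<nu> = (\<integral>\<^sup>+w. (\<integral>\<^sup>+x. ?e x w \<partial>\<nu>)\<^sup>2 \<partial>lborel)"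
      by (rule gaussian_energy_eq_square[OF nu(1,2) t])
    also have "\<dots> = (\<integral>\<^sup>+w. ((\<Sum>U\<in>F. g U w) / ennreal (card F))\<^sup>2 \<partial>lborel)"
      unfolding g_def by (subst mix) auto
    \<comment> \<open>Convexity of the square at each \<open>w\<close>. The averaged squares then
      integrate to the energies of the push-forwards, all equal to that of \<open>\<mu>\<close>
      because each \<open>U\<close> preserves distances.\<close>
    also have "\<dots> \<le> (\<integral>\<^sup>+w. (\<Sum>U\<in>F. (g U w)\<^sup>2) / ennreal (card F) \<partial>lborel)"
      using F gfin by (intro nn_integral_mono square_mean_le_mean_square_ennreal)
    also have "\<dots> = (\<Sum>U\<in>F. \<integral>\<^sup>+w. (g U w)\<^sup>2 \<partial>lborel) / ennreal (card F)"
      by (simp add: nn_integral_divide nn_integral_sum)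
    also have "\<dots> = ?C * gaussian_energy t \<mu>"
      using F by (simp add: gU ennreal_of_nat_eq_real_of_nat[symmetric] mult.commute[of "of_nat _"]
          mult_divide_eq_ennreal card_gt_0_iff)
    finally have "?C * gaussian_energy t \<nu> \<le> ?C * gaussian_energy t \<mu>" .
    moreover have "?C \<noteq> 0" "?C \<noteq> top" using t by auto
    ultimately show ?thesis by (subst (asm) ennreal_mult_le_mult_iff)
  qed
  have eq: "2 * shifted_log_energy D \<omega>
      = (\<integral>\<^sup>+t. indicator {0<..} t * (ennreal (1 / t) * (gaussian_energy t \<omega> - ennreal (exp (- t * D\<^sup>2)))) \<partial>lborel)"
    if "\<omega> \<in> borel_probs_supported K" for \<omega>
    by (rule shifted_log_energy_gaussian[OF that]) (use D in auto)
  \<comment> \<open>The subtracted constant exp(-t D^2) is the same for both measures, as both have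
    mass 1; this is where only conditional positive definiteness of the logarithm enters.\<close>
  have "2 * shifted_log_energy D \<nu> \<le> 2 * shifted_log_energy D \<mu>"
    unfolding eq[OF \<mu>] eq[OF \<nu>]
    by (intro nn_integral_mono)
      (auto split: split_indicator intro!: mult_left_mono ennreal_minus_mono gauss)
  then show ?thesis by (subst (asm) ennreal_mult_le_mult_iff) auto
qed

section \<open>Bounded energy and separated balls\<close>

lemma shifted_log_energy_pair:
  fixes \<nu> :: "'a::euclidean_space measure"
  assumes "prob_space \<nu>" and sets [measurable_cong]: "sets \<nu> = sets borel"
  shows "shifted_log_energy D \<nu> = (\<integral>\<^sup>+xy. shifted_log_kernel D (fst xy - snd xy) \<partial>(\<nu> \<Otimes>\<^sub>M \<nu>))"
proof -
  interpret prob_space \<nu> by fact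
  interpret P: pair_prob_space \<nu> \<nu> ..
  show ?thesis
    unfolding shifted_log_energy_def
    by (subst P.nn_integral_snd[symmetric]) (auto simp: case_prod_unfold)
qed

lemma AE_pair_supported:
  fixes \<nu> :: "'a::euclidean_space measure"
  assumes \<nu>: "\<nu> \<in> borel_probs_supported K" and K: "compact K"
  shows "AE xy in \<nu> \<Otimes>\<^sub>M \<nu>. fst xy \<in> K \<and> snd xy \<in> K"
proof -
  note nu = borel_probs_supportedD[OF \<nu>]
  have [measurable_cong]: "sets \<nu> = sets borel" by (rule nu)
  interpret prob_space \<nu> by (rule nu)
  interpret P: pair_prob_space \<nu> \<nu> ..
  have KM: "K \<in> sets borel" using K by (simp add: compact_imp_closed)
  have "AE x in \<nu>. AE y in \<nu>. x \<in> K \<and> y \<in> K" using nu(3) by (auto elim!: eventually_mono)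
  then show ?thesis using KM by (subst P.AE_pair_iff[symmetric]) auto
qed

text \<open>Markov's inequality: the kernel is at least 2B + 1 on pairs closer than
  \<open>s\<close>, so such pairs have mass below 1/2. The remaining mass is covered by finitely
  many products of balls with distant centres, and one product must be heavy. \<open>r\<close> comes
  before \<open>\<tau>\<close>, and \<open>p\<close> depends on \<open>\<tau>\<close> but not on the
  measure.\<close>

lemma energy_bound_mass_in_separated_balls:
  fixes K :: "'a::euclidean_space set"
  assumes K: "compact K" and D: "D > 0" and B: "B \<ge> 0"
  obtains r where "r > 0"
    "\<And>\<tau>. 0 < \<tau> \<Longrightarrow> \<tau> \<le> r \<Longrightarrow> \<exists>p>0. \<forall>\<mu>\<in>borel_probs_supported K. shifted_log_energy D \<mu> \<le> ennreal B \<longrightarrow>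
      (\<exists>a\<in>K. \<exists>b\<in>K. r \<le> norm (a - b) \<and> p \<le> measure \<mu> (cball a \<tau>) \<and> p \<le> measure \<mu> (cball b \<tau>))"
proof -
  \<comment> \<open>Solves ln (D / s) = 2B + 1.\<close>
  define s where "s = D * exp (- (2 * B + 1))"
  have s0: "s > 0" using D by (simp add: s_def)
  show thesis
  proof (rule that[of "s / 3"])
    show "s / 3 > 0" using s0 by simp
    fix \<tau> :: real assume \<tau>: "0 < \<tau>" "\<tau> \<le> s / 3"
    obtain C where C: "C \<subseteq> K" "finite C" "K \<subseteq> (\<Union>c\<in>C. ball c \<tau>)"
      using compactE_image[OF K, of K "\<lambda>c. ball c \<tau>"] \<tau> by force
    \<comment> \<open>Bounds the number of pairs of centres; adding 1 keeps it positive even for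
      empty \<open>C\<close>.\<close>
    define n where "n = (real (card C))\<^sup>2 + 1"
    have n0: "n > 0" unfolding n_def by (smt (verit) zero_le_power2)
    define p where "p = 1 / (2 * n)"
    have p0: "p > 0" using n0 by (simp add: p_def)
    have "\<exists>a\<in>K. \<exists>b\<in>K. s / 3 \<le> norm (a - b) \<and> p \<le> measure \<mu> (cball a \<tau>) \<and> p \<le> measure \<mu> (cball b \<tau>)"
      if \<mu>: "\<mu> \<in> borel_probs_supported K" and en: "shifted_log_energy D \<mu> \<le> ennreal B" for \<mu>
    proof (rule ccontr)
      assume neg: "\<not> ?thesis"
      have pr: "prob_space \<mu>" and sets [measurable_cong]: "sets \<mu> = sets borel" and AE: "AE x in \<mu>. x \<in> K"
        using \<mu> by (auto simp: borel_probs_supported_def)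
      interpret prob_space \<mu> by fact
      interpret P: pair_prob_space \<mu> \<mu> ..
      let ?N = "\<mu> \<Otimes>\<^sub>M \<mu>"
      let ?S = "{xy \<in> space ?N. norm (fst xy - snd xy) < s}"
      have space: "space \<mu> = UNIV" using sets_eq_imp_space_eq[OF sets] by simp
      note en2 = shifted_log_energy_pair[OF pr sets]
      have "ennreal (2 * B + 1) * emeasure ?N ?S = (\<integral>\<^sup>+xy. ennreal (2 * B + 1) * indicator ?S xy \<partial>?N)"
        by (subst nn_integral_cmult_indicator) measurable
      also have "\<dots> \<le> shifted_log_energy D \<mu>"
        unfolding en2
      proof (rule nn_integral_mono)
        fix xy :: "'a \<times> 'a"
        show "ennreal (2 * B + 1) * indicator ?S xy \<le> shifted_log_kernel D (fst xy - snd xy)"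
        proof (cases "xy \<in> ?S \<and> fst xy \<noteq> snd xy")
          case True
          then have "norm (fst xy - snd xy) < s" "norm (fst xy - snd xy) > 0" by auto
          then have "D / s \<le> D / norm (fst xy - snd xy)" using D s0 by (intro divide_left_mono) auto
          moreover have "D / s = exp (2 * B + 1)" using D by (simp add: s_def exp_minus field_simps flip: exp_add)
          ultimately have "exp (2 * B + 1) \<le> D / norm (fst xy - snd xy)" by simp
          then have "2 * B + 1 \<le> ln (D / norm (fst xy - snd xy))"
            using D True by (subst ln_ge_iff) auto
          then show ?thesis using True by (simp add: shifted_log_kernel_def ennreal_leI)
        next
          case False
          then show ?thesis by (auto simp: shifted_log_kernel_def split: split_indicator)
        qed
      qed
      also have "\<dots> \<le> ennreal B" by (rule en)
      finally have "ennreal ((2 * B + 1) * measure ?N ?S) \<le> ennreal B"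
        using B by (simp add: P.emeasure_eq_measure ennreal_mult)
      then have "(2 * B + 1) * measure ?N ?S \<le> B" using B by (simp add: ennreal_le_iff)
      then have "(2 * B + 1) * (2 * measure ?N ?S - 1) < 0" by (simp add: algebra_simps)
      then have half: "measure ?N ?S < 1 / 2" using B by (simp add: mult_less_0_iff)
      define Q where "Q = {(a, b) \<in> C \<times> C. s / 3 \<le> norm (a - b)}"
      have Q: "finite Q" "Q \<subseteq> C \<times> C" using C(2) by (auto simp: Q_def intro: finite_subset[of _ "C \<times> C"])
      define W where "W = (\<Union>q\<in>Q. cball (fst q) \<tau> \<times> cball (snd q) \<tau>)"
      have [measurable]: "W \<in> sets ?N"
        unfolding W_def using Q(1) by (intro sets.finite_UN pair_measureI) (auto simp: sets)
      note AE2 = AE_pair_supported[OF \<mu> K]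
      have "AE xy in ?N. xy \<in> ?S \<union> W"
        using AE2
      proof eventually_elim
        case (elim xy)
        then obtain a b where ab: "a \<in> C" "b \<in> C" "fst xy \<in> ball a \<tau>" "snd xy \<in> ball b \<tau>"
          using C(3) by blast
        show ?case
        proof (cases "norm (fst xy - snd xy) < s")
          case True
          then show ?thesis by (simp add: space_pair_measure space)
        next
          case False
          have "fst xy - snd xy = (fst xy - a) + (a - b) + (b - snd xy)" by simp
          then have "norm (fst xy - snd xy) \<le> norm (fst xy - a) + norm (a - b) + norm (b - snd xy)"
            by (metis norm_triangle_ineq norm_triangle_le add_mono order_refl)
          \<comment> \<open>The points are at least \<open>s\<close> apart and each lies within s/3
            of its centre.\<close>
          then have "s / 3 \<le> norm (a - b)"
            using ab False \<tau> by (simp add: dist_norm norm_minus_commute)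
          then have "(a, b) \<in> Q" using ab by (simp add: Q_def)
          then show ?thesis using ab unfolding W_def by (intro UnI2 UN_I[of "(a, b)"]) (auto simp: mem_Times_iff)
        qed
      qed
      then have "P.prob (?S \<union> W) = 1" by (subst P.prob_eq_1) auto
      then have "1 \<le> P.prob (?S \<union> W)" by simp
      also have "\<dots> \<le> measure ?N ?S + measure ?N W" by (intro measure_Un_le) measurable
      finally have W1: "1 / 2 < measure ?N W" using half by linarith
      have "measure ?N W \<le> (\<Sum>q\<in>Q. measure ?N (cball (fst q) \<tau> \<times> cball (snd q) \<tau>))"
        unfolding W_def using Q(1) by (intro P.finite_measure_subadditive_finite) (auto simp: sets)
      also have "\<dots> \<le> (\<Sum>q\<in>Q. p)"
      proof (rule sum_mono)
        fix q assume q: "q \<in> Q"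
        have "emeasure ?N (cball (fst q) \<tau> \<times> cball (snd q) \<tau>)
            = emeasure \<mu> (cball (fst q) \<tau>) * emeasure \<mu> (cball (snd q) \<tau>)"
          by (intro emeasure_pair_measure_Times) (auto simp: sets)
        then have eq: "measure ?N (cball (fst q) \<tau> \<times> cball (snd q) \<tau>)
            = measure \<mu> (cball (fst q) \<tau>) * measure \<mu> (cball (snd q) \<tau>)"
          by (simp add: measure_def enn2real_mult)
        have "measure \<mu> (cball (fst q) \<tau>) < p \<or> measure \<mu> (cball (snd q) \<tau>) < p"
        proof -
          have "fst q \<in> K" "snd q \<in> K" "s / 3 \<le> norm (fst q - snd q)"
            using q C(1) by (auto simp: Q_def)
          then show ?thesis using neg by (meson not_le)
        qed
        moreover have "measure \<mu> (cball (fst q) \<tau>) \<le> 1" "measure \<mu> (cball (snd q) \<tau>) \<le> 1" by auto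
        moreover have "x * y \<le> p" if "x < p \<or> y < p" "0 \<le> x" "x \<le> 1" "0 \<le> y" "y \<le> 1" for x y :: real
          using that mult_left_le[of y x] mult_right_le_one_le[of y x] by (auto simp: mult.commute)
        ultimately show "measure ?N (cball (fst q) \<tau> \<times> cball (snd q) \<tau>) \<le> p"
          unfolding eq by simp
      qed
      also have "\<dots> \<le> (real (card C))\<^sup>2 * p"
        using card_mono[OF _ Q(2)] C(2) p0
        by (simp add: card_cartesian_product power2_eq_square flip: of_nat_mult)
      also have "\<dots> \<le> n * p" using p0 by (simp add: n_def)
      also have "\<dots> = 1 / 2" using n0 by (simp add: p_def)
      finally show False using W1 by simp
    qed
    then show "\<exists>p>0. \<forall>\<mu>\<in>borel_probs_supported K. shifted_log_energy D \<mu> \<le> ennreal B \<longrightarrow>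
      (\<exists>a\<in>K. \<exists>b\<in>K. s / 3 \<le> norm (a - b) \<and> p \<le> measure \<mu> (cball a \<tau>) \<and> p \<le> measure \<mu> (cball b \<tau>))"
      using p0 by blast
  qed
qed

section \<open>Transport of measures and the energy gap\<close>

text \<open>Otherwise a closed half-space missing 0 would contain the hull. The margin
  \<open>\<epsilon>\<close> is due to the closure.\<close>

lemma linear_functional_on_closed_hull:
  fixes f :: "'a::euclidean_space \<Rightarrow> real"
  assumes f: "linear f" and "0 \<in> closure (convex hull A)" "\<epsilon> > 0"
  shows "\<exists>x\<in>A. - \<epsilon> < f x"
proof (rule ccontr)
  assume "\<not> ?thesis"
  then have "A \<subseteq> {x. f x \<le> - \<epsilon>}" by (auto simp: not_less)
  moreover have "convex {x. f x \<le> - \<epsilon>}"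
    using convex_linear_vimage[OF f, of "{..- \<epsilon>}"] by (simp add: vimage_def)
  moreover have "closed {x. f x \<le> - \<epsilon>}"
    using f by (intro closed_Collect_le linear_continuous_on continuous_on_const)
      (simp add: linear_conv_bounded_linear)
  ultimately have "closure (convex hull A) \<subseteq> {x. f x \<le> - \<epsilon>}"
    by (intro closure_minimal hull_minimal)
  then show False using assms linear_0[OF f] by auto
qed

lemma eigen_defect_measurable [measurable]: "eigen_defect A \<in> borel_measurable borel"
  by (intro borel_measurable_continuous_onI continuous_intros)

lemma norm_matrix_vector_le: "norm (A *v x) \<le> onorm ((*v) A) * norm x" for A :: "real^'n^'m"
  by (rule onorm) (simp add: linear_conv_bounded_linear[symmetric])

lemma eigen_defect_le:
  "eigen_defect A z \<le> (onorm ((*v) A))\<^sup>2 * (norm z) ^ 4"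
proof -
  have "eigen_defect A z \<le> (norm z)\<^sup>2 * (norm (A *v z))\<^sup>2" by (simp add: eigen_defect_def)
  also have "\<dots> \<le> (norm z)\<^sup>2 * (onorm ((*v) A) * norm z)\<^sup>2"
    by (intro mult_left_mono power_mono norm_matrix_vector_le) auto
  finally show ?thesis by (simp add: power_mult_distrib power4_eq_xxxx power2_eq_square mult_ac)
qed

text \<open>The first-order change of the energy in the direction \<open>X\<close>. Being linear in
  \<open>X\<close>, it can be evaluated on the hull of the conjugates; on the diagonal the integrand
  is 0 by division by zero.\<close>

definition normalized_quadratic_mean :: "(real^'n) measure \<Rightarrow> real^'n^'n \<Rightarrow> real" where
  "normalized_quadratic_mean \<nu> X =
    (\<integral>xy. (fst xy - snd xy) \<bullet> (X *v (fst xy - snd xy)) / (norm (fst xy - snd xy))\<^sup>2 \<partial>(\<nu> \<Otimes>\<^sub>M \<nu>))"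

lemma normalized_quadratic_integrable:
  fixes \<nu> :: "(real^'n) measure"
  assumes "prob_space \<nu>" and sets [measurable_cong]: "sets \<nu> = sets borel"
  shows "integrable (\<nu> \<Otimes>\<^sub>M \<nu>)
    (\<lambda>xy. (fst xy - snd xy) \<bullet> (X *v (fst xy - snd xy)) / (norm (fst xy - snd xy))\<^sup>2)"
proof -
  interpret prob_space \<nu> by fact
  interpret P: pair_prob_space \<nu> \<nu> ..
  have "\<bar>z \<bullet> (X *v z) / (norm z)\<^sup>2\<bar> \<le> onorm ((*v) X)" for z
  proof (cases "z = 0")
    case True
    then show ?thesis by (simp add: onorm_pos_le linear_conv_bounded_linear[symmetric])
  next
    case False
    have "\<bar>z \<bullet> (X *v z)\<bar> \<le> norm z * (onorm ((*v) X) * norm z)"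
      by (rule order.trans[OF Cauchy_Schwarz_ineq2]) (intro mult_left_mono norm_matrix_vector_le norm_ge_zero)
    then show ?thesis using False by (simp add: divide_le_eq power2_eq_square mult_ac)
  qed
  then show ?thesis by (intro P.integrable_const_bound[where B="onorm ((*v) X)"]) auto
qed

lemma linear_normalized_quadratic_mean:
  fixes \<nu> :: "(real^'n) measure"
  assumes \<nu>: "prob_space \<nu>" "sets \<nu> = sets borel"
  shows "linear (normalized_quadratic_mean \<nu>)"
proof (rule linearI)
  note int = normalized_quadratic_integrable[OF \<nu>]
  fix X Y :: "real^'n^'n" and c :: real
  show "normalized_quadratic_mean \<nu> (X + Y) = normalized_quadratic_mean \<nu> X + normalized_quadratic_mean \<nu> Y"
    unfolding normalized_quadratic_mean_def
    by (subst Bochner_Integration.integral_add[symmetric, OF int int])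
      (simp add: matrix_vector_mult_add_rdistrib inner_right_distrib add_divide_distrib)
  show "normalized_quadratic_mean \<nu> (c *\<^sub>R X) = c *\<^sub>R normalized_quadratic_mean \<nu> X"
    unfolding normalized_quadratic_mean_def
    by (simp add: scaleR_matrix_vector_assoc[symmetric] flip: times_divide_eq_right)
qed

lemma eigen_defect_integrable:
  fixes \<nu> :: "(real^'n) measure"
  assumes \<nu>: "\<nu> \<in> borel_probs_supported K" and K: "compact K"
    and D: "\<And>x y. x \<in> K \<Longrightarrow> y \<in> K \<Longrightarrow> norm (x - y) \<le> D" and W: "orthogonal_matrix W"
  shows "integrable (\<nu> \<Otimes>\<^sub>M \<nu>) (\<lambda>xy. eigen_defect A (W *v (fst xy - snd xy)))"
proof -
  note nu = borel_probs_supportedD[OF \<nu>]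
  have [measurable_cong]: "sets \<nu> = sets borel" by (rule nu)
  interpret prob_space \<nu> by (rule nu)
  interpret P: pair_prob_space \<nu> \<nu> ..
  have "AE xy in \<nu> \<Otimes>\<^sub>M \<nu>. norm (eigen_defect A (W *v (fst xy - snd xy))) \<le> (onorm ((*v) A))\<^sup>2 * D ^ 4"
    using AE_pair_supported[OF \<nu> K]
  proof eventually_elim
    case (elim xy)
    have "eigen_defect A (W *v (fst xy - snd xy)) \<le> (onorm ((*v) A))\<^sup>2 * (norm (W *v (fst xy - snd xy))) ^ 4"
      by (rule eigen_defect_le)
    also have "\<dots> \<le> (onorm ((*v) A))\<^sup>2 * D ^ 4"
      unfolding norm_orthogonal_matrix_vector[OF W] using elim D
      by (intro mult_left_mono power_mono) auto
    finally show ?case by (simp add: eigen_defect_nonneg)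
  qed
  then show ?thesis by (rule P.integrable_const_bound) measurable
qed

text \<open>The bound \<open>lb\<close> is applied to \<open>W z\<close> for the differences z = x -
  y and integrated over the product measure. Since \<open>W\<close> preserves norms, it only
  conjugates \<open>L\<close> and rotates the argument of the defect.\<close>

lemma shifted_log_energy_transport:
  fixes M W L :: "real^'n^'n"
  assumes \<nu>: "\<nu> \<in> borel_probs_supported K" and K: "compact K" and fin: "shifted_log_energy D \<nu> < top"
    and D: "D > 0" "\<And>x y. x \<in> K \<Longrightarrow> y \<in> K \<Longrightarrow> norm (x - y) \<le> D"
    and DM: "\<And>x y. x \<in> linear_image M K \<Longrightarrow> y \<in> linear_image M K \<Longrightarrow> norm (x - y) \<le> D"
    and W: "orthogonal_matrix W" "linear_image W K = K" and M: "invertible M" and c: "c > 0"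
    and lb: "\<And>z. z \<noteq> 0 \<Longrightarrow> ln (norm (M *v z) / norm z) \<ge>
       z \<bullet> (L *v z) / (norm z)\<^sup>2 + c * eigen_defect A z / (norm z) ^ 4"
  shows "shifted_log_energy D (distr \<nu> borel ((*v) (M ** W))) < top" (is "?E < top")
    and "enn2real (shifted_log_energy D (distr \<nu> borel ((*v) (M ** W)))) \<le> enn2real (shifted_log_energy D \<nu>)
      - normalized_quadratic_mean \<nu> (transpose W ** L ** W)
      - c / D ^ 4 * (\<integral>xy. eigen_defect A (W *v (fst xy - snd xy)) \<partial>(\<nu> \<Otimes>\<^sub>M \<nu>))"
proof -
  note nu = borel_probs_supportedD[OF \<nu>]
  have [measurable_cong]: "sets \<nu> = sets borel" by (rule nu)
  interpret prob_space \<nu> by (rule nu)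
  interpret P: pair_prob_space \<nu> \<nu> ..
  let ?N = "\<nu> \<Otimes>\<^sub>M \<nu>"
  define z where "z = (\<lambda>xy :: (real^'n) \<times> (real^'n). fst xy - snd xy)"
  have [measurable]: "z \<in> borel_measurable (borel \<Otimes>\<^sub>M borel)" unfolding z_def by measurable
  define k where "k = (\<lambda>xy. ln (D / norm (z xy)))"
  define q where "q = (\<lambda>xy. z xy \<bullet> ((transpose W ** L ** W) *v z xy) / (norm (z xy))\<^sup>2)"
  define d where "d = (\<lambda>xy. eigen_defect A (W *v z xy))"
  have en: "shifted_log_energy D \<nu> = (\<integral>\<^sup>+xy. shifted_log_kernel D (z xy) \<partial>?N)"
    unfolding z_def by (rule shifted_log_energy_pair[OF nu(1,2)])
  \<comment> \<open>Finite energy makes the diagonal a null set, so \<open>lb\<close> is available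
    almost everywhere.\<close>
  have "AE xy in ?N. shifted_log_kernel D (z xy) \<noteq> \<infinity>"
    using fin unfolding en by (intro nn_integral_noteq_infinite) auto
  then have AE0: "AE xy in ?N. z xy \<noteq> 0 \<and> norm (z xy) \<le> D \<and> fst xy \<in> K \<and> snd xy \<in> K"
    using AE_pair_supported[OF \<nu> K]
    by eventually_elim (use D in \<open>auto simp: shifted_log_kernel_def z_def split: if_splits\<close>)
  have kpos: "AE xy in ?N. 0 \<le> k xy"
    using AE0 by eventually_elim (use D in \<open>auto simp: k_def intro!: ln_ge_zero\<close>)
  have enk: "shifted_log_energy D \<nu> = (\<integral>\<^sup>+xy. ennreal (k xy) \<partial>?N)"
    unfolding en by (intro nn_integral_cong_AE, use AE0 in eventually_elim)
      (auto simp: k_def shifted_log_kernel_def)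
  have [measurable]: "k \<in> borel_measurable ?N" "d \<in> borel_measurable ?N"
    unfolding k_def d_def by measurable
  have intk: "integrable ?N k"
    using kpos fin unfolding enk by (intro integrableI_nonneg) auto
  have Ik: "enn2real (shifted_log_energy D \<nu>) = integral\<^sup>L ?N k"
    using nn_integral_eq_integral[OF intk kpos] integral_nonneg_AE[OF kpos] by (simp add: enk)
  have intq: "integrable ?N q"
    unfolding q_def z_def by (rule normalized_quadratic_integrable[OF nu(1,2)])
  have intd: "integrable ?N d"
    unfolding d_def z_def by (rule eigen_defect_integrable[OF \<nu> K _ W(1)]) (use D in auto)
  define h where "h = (\<lambda>xy. k xy - q xy - c / D ^ 4 * d xy)"
  have inth: "integrable ?N h" unfolding h_def using intk intq intd by simp
  have pw: "AE xy in ?N. shifted_log_kernel D ((M ** W) *v z xy) \<le> ennreal (h xy) \<and> 0 \<le> h xy"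
    using AE0
  proof eventually_elim
    case (elim xy)
    define w where "w = W *v z xy"
    have nw: "norm w = norm (z xy)" by (simp add: w_def norm_orthogonal_matrix_vector[OF W(1)])
    then have w0: "w \<noteq> 0" using elim by auto
    have Mw: "M *v w \<noteq> 0"
      using M w0 by (metis invertible_def matrix_vector_mul_assoc matrix_vector_mul_lid matrix_vector_mult_0_right)
    have "W *v fst xy \<in> K" "W *v snd xy \<in> K" using W(2) elim by (auto simp: linear_image_def)
    then have "norm (M *v (W *v fst xy) - M *v (W *v snd xy)) \<le> D"
      by (intro DM) (auto simp: linear_image_def)
    then have MwD: "norm (M *v w) \<le> D" by (simp add: w_def z_def matrix_vector_mult_diff_distrib)
    have qw: "w \<bullet> (L *v w) / (norm w)\<^sup>2 = q xy"
      unfolding q_def nw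
      by (simp add: w_def matrix_vector_mul_assoc[symmetric] transpose_matrix_vector
          dot_lmul_matrix[of _ W] inner_commute[of "z xy"] inner_commute[of "W *v z xy"])
    \<comment> \<open>Trading |w|^4 for the larger \<open>D ^ 4\<close> leaves a remainder that is
      continuous in the difference and easy to bound below on balls.\<close>
    have "d xy / D ^ 4 \<le> d xy / (norm w) ^ 4"
      using elim D w0 unfolding nw d_def
      by (intro divide_left_mono power_mono eigen_defect_nonneg) auto
    then have "c / D ^ 4 * d xy \<le> c * eigen_defect A w / (norm w) ^ 4"
      using mult_left_mono[of "d xy / D ^ 4" "d xy / (norm w) ^ 4" c] c by (simp add: d_def w_def)
    then have "q xy + c / D ^ 4 * d xy \<le> ln (norm (M *v w) / norm w)"
      using lb[OF w0] qw by linarith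
    moreover have "ln (D / norm (M *v w)) = k xy - ln (norm (M *v w) / norm w)"
      using D w0 Mw elim by (simp add: k_def nw ln_div)
    ultimately have "ln (D / norm (M *v w)) \<le> h xy" by (simp add: h_def)
    \<comment> \<open>The diameter bound for the image of \<open>K\<close> thus gives
      \<open>h \<ge> 0\<close>, which permits passing to the Bochner integral.\<close>
    moreover have "0 \<le> ln (D / norm (M *v w))" using D MwD Mw by (intro ln_ge_zero) auto
    moreover have "(M ** W) *v z xy = M *v w" by (simp add: w_def matrix_vector_mul_assoc)
    ultimately show ?case using Mw by (auto simp: shifted_log_kernel_def intro: ennreal_leI)
  qed
  then have hpos: "AE xy in ?N. 0 \<le> h xy" by eventually_elim simp
  have "?E = (\<integral>\<^sup>+y. \<integral>\<^sup>+x. shifted_log_kernel D ((M ** W) *v (x - y)) \<partial>\<nu> \<partial>\<nu>)"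
    by (rule shifted_log_energy_distr[OF nu(1,2)])
  also have "\<dots> = (\<integral>\<^sup>+xy. shifted_log_kernel D ((M ** W) *v z xy) \<partial>?N)"
    unfolding z_def by (subst P.nn_integral_snd[symmetric]) (auto simp: case_prod_unfold)
  also have "\<dots> \<le> (\<integral>\<^sup>+xy. ennreal (h xy) \<partial>?N)"
    using pw by (intro nn_integral_mono_AE) auto
  also have "\<dots> = ennreal (integral\<^sup>L ?N h)" by (rule nn_integral_eq_integral[OF inth hpos])
  finally have le: "?E \<le> ennreal (integral\<^sup>L ?N h)" .
  then show "?E < top" by (simp add: order_le_less_trans)
  have "enn2real ?E \<le> integral\<^sup>L ?N h"
    using le integral_nonneg_AE[OF hpos] by (intro enn2real_leI)
  also have "\<dots> = integral\<^sup>L ?N k - integral\<^sup>L ?N q - c / D ^ 4 * integral\<^sup>L ?N d"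
    unfolding h_def using intk intq intd by simp
  finally show "enn2real ?E \<le> enn2real (shifted_log_energy D \<nu>)
      - normalized_quadratic_mean \<nu> (transpose W ** L ** W)
      - c / D ^ 4 * (\<integral>xy. eigen_defect A (W *v (fst xy - snd xy)) \<partial>?N)"
    unfolding Ik normalized_quadratic_mean_def q_def d_def z_def .
qed

lemma integral_ge_on_rectangle:
  assumes "prob_space \<nu>" and f: "integrable (\<nu> \<Otimes>\<^sub>M \<nu>) f" "\<And>xy. 0 \<le> f xy"
    and S: "S \<in> sets \<nu>" "R \<in> sets \<nu>" "p \<le> measure \<nu> S" "p \<le> measure \<nu> R" "0 \<le> p"
    and e: "0 \<le> e" "\<And>x y. x \<in> S \<Longrightarrow> y \<in> R \<Longrightarrow> e \<le> f (x, y)"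
  shows "e * p\<^sup>2 \<le> integral\<^sup>L (\<nu> \<Otimes>\<^sub>M \<nu>) f"
proof -
  interpret prob_space \<nu> by fact
  interpret P: pair_prob_space \<nu> \<nu> ..
  let ?N = "\<nu> \<Otimes>\<^sub>M \<nu>"
  have SR: "S \<times> R \<in> sets ?N" using S by simp
  have "p\<^sup>2 \<le> measure \<nu> S * measure \<nu> R"
    unfolding power2_eq_square using S by (intro mult_mono) auto
  also have "\<dots> = measure ?N (S \<times> R)"
    using S by (simp add: measure_def emeasure_pair_measure_Times enn2real_mult)
  finally have "e * p\<^sup>2 \<le> e * measure ?N (S \<times> R)" using e by (intro mult_left_mono)
  also have "\<dots> = (\<integral>xy. e * indicator (S \<times> R) xy \<partial>?N)" using SR by simp
  also have "\<dots> \<le> integral\<^sup>L ?N f"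
    using SR f e by (intro integral_mono integrable_mult_right) (auto split: split_indicator simp: P.emeasure_eq_measure)
  finally show ?thesis .
qed

text \<open>The constants \<open>r\<close>, \<open>\<delta>\<close>, \<open>d\<close>,
  \<open>\<tau>\<close>, \<open>p\<close>, \<open>\<eta>\<close> are fixed in this order before
  \<open>\<mu>\<close> is given; the average \<open>\<nu>\<close> and then \<open>W\<close> follow.
  Hence \<open>\<eta>\<close> serves all measures of energy at most \<open>B\<close>.\<close>

lemma uniform_energy_gap:
  fixes M :: "real^'n^'n" and K :: "(real^'n) set"
  assumes G: "orthogonal_matrix_group G" "irreducible_matrix_group G" "\<And>U. U \<in> G \<Longrightarrow> linear_image U K = K"
    and det: "det M = 1 \<or> det M = -1" and M: "\<not> orthogonal_matrix M" and K: "compact K" and B: "B \<ge> 0"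
    and D: "D \<ge> 1" "\<And>x y. x \<in> K \<Longrightarrow> y \<in> K \<Longrightarrow> norm (x - y) \<le> D"
    and DM: "\<And>x y. x \<in> linear_image M K \<Longrightarrow> y \<in> linear_image M K \<Longrightarrow> norm (x - y) \<le> D"
  obtains \<eta> where "\<eta> > 0"
    "\<And>\<mu>. \<mu> \<in> borel_probs_supported K \<Longrightarrow> shifted_log_energy D \<mu> \<le> ennreal B \<Longrightarrow>
      \<exists>\<nu>\<in>borel_probs_supported (linear_image M K). shifted_log_energy D \<nu> < top \<and>
        enn2real (shifted_log_energy D \<nu>) + \<eta> \<le> enn2real (shifted_log_energy D \<mu>)"
proof -
  define T where "T = transpose M ** M"
  have D0: "D > 0" using D by simp
  have Gorth: "orthogonal_matrix U" if "U \<in> G" for U using G(1) that by (simp add: orthogonal_matrix_group_def)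
  obtain L c where L: "transpose L = L" "trace L = 0" and c: "c > 0"
    and lb: "\<And>z. z \<noteq> 0 \<Longrightarrow> ln (norm (M *v z) / norm z) \<ge>
       z \<bullet> (L *v z) / (norm z)\<^sup>2 + c * eigen_defect T z / (norm z) ^ 4"
    using ln_norm_ratio_lower_bound[OF det] unfolding T_def by metis
  have "mat 1 \<in> G" using G(1) by (simp add: orthogonal_matrix_group_def)
  then obtain F where F: "finite F" "mat 1 \<in> F" "F \<subseteq> G" "G \<subseteq> span F"
    using finite_spanning_subset by blast
  define m where "m = real (card F)"
  have m0: "m > 0" using F by (auto simp: m_def card_gt_0_iff)
  obtain r where r: "r > 0"
    and sep: "\<And>\<tau>. 0 < \<tau> \<Longrightarrow> \<tau> \<le> r \<Longrightarrow> \<exists>p>0. \<forall>\<mu>\<in>borel_probs_supported K. shifted_log_energy D \<mu> \<le> ennreal B \<longrightarrow>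
      (\<exists>a\<in>K. \<exists>b\<in>K. r \<le> norm (a - b) \<and> p \<le> measure \<mu> (cball a \<tau>) \<and> p \<le> measure \<mu> (cball b \<tau>))"
    using energy_bound_mass_in_separated_balls[OF K D0 B] by metis
  obtain \<delta> where \<delta>: "\<delta> > 0"
    and def: "\<And>W a b. orthogonal_matrix W \<Longrightarrow> a \<in> K \<Longrightarrow> b \<in> K \<Longrightarrow> r \<le> norm (a - b) \<Longrightarrow>
      \<exists>U\<in>F. \<exists>V\<in>F. \<exists>x\<in>{a,b}. \<exists>y\<in>{a,b}. eigen_defect T (W *v (U *v x - V *v y)) \<ge> \<delta>"
    using uniform_positive_defect[OF G(1,2) F det M K r] unfolding T_def by metis
  have "uniformly_continuous_on (cball 0 (D + 2)) (eigen_defect T)"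
    by (intro compact_uniformly_continuous continuous_intros) auto
  then obtain d where d: "d > 0"
    and uc: "\<And>z w. z \<in> cball 0 (D + 2) \<Longrightarrow> w \<in> cball 0 (D + 2) \<Longrightarrow> dist z w < d \<Longrightarrow>
      dist (eigen_defect T z) (eigen_defect T w) < \<delta> / 2"
    unfolding uniformly_continuous_on_def using \<delta> by (metis half_gt_zero)
  \<comment> \<open>Moving both points by at most \<open>\<tau>\<close> changes their difference by
    at most \<open>2 * \<tau>\<close>: below \<open>d\<close>, and at most 2, which explains the
    radius \<open>D + 2\<close> above.\<close>
  define \<tau> where "\<tau> = min r (min 1 (d / 3))"
  have \<tau>: "0 < \<tau>" "\<tau> \<le> r" "\<tau> \<le> 1" "2 * \<tau> < d" using r d by (auto simp: \<tau>_def)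
  obtain p where p: "p > 0"
    and mass: "\<And>\<mu>. \<mu> \<in> borel_probs_supported K \<Longrightarrow> shifted_log_energy D \<mu> \<le> ennreal B \<Longrightarrow>
      (\<exists>a\<in>K. \<exists>b\<in>K. r \<le> norm (a - b) \<and> p \<le> measure \<mu> (cball a \<tau>) \<and> p \<le> measure \<mu> (cball b \<tau>))"
    using sep[OF \<tau>(1,2)] by metis
  \<comment> \<open>Half of the guaranteed remainder; the other half absorbs the error in the choice
    of \<open>W\<close>. The \<open>\<delta> / 2\<close> is what survives on the balls, and p/m is
    their mass under the average.\<close>
  define \<eta> where "\<eta> = c / D ^ 4 * (\<delta> / 2 * (p / m)\<^sup>2) / 2"
  have \<eta>: "\<eta> > 0" using c D0 \<delta> p m0 by (simp add: \<eta>_def)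
  have "\<exists>\<nu>\<in>borel_probs_supported (linear_image M K). shifted_log_energy D \<nu> < top \<and>
        enn2real (shifted_log_energy D \<nu>) + \<eta> \<le> enn2real (shifted_log_energy D \<mu>)"
    if \<mu>: "\<mu> \<in> borel_probs_supported K" and en: "shifted_log_energy D \<mu> \<le> ennreal B" for \<mu>
  proof -
    note mu = borel_probs_supportedD[OF \<mu>]
    interpret \<mu>: prob_space \<mu> by (rule mu)
    obtain a b where ab: "a \<in> K" "b \<in> K" "r \<le> norm (a - b)"
      and pab: "\<And>x. x \<in> {a, b} \<Longrightarrow> p \<le> measure \<mu> (cball x \<tau>)" using mass[OF \<mu> en] by blast
    have isoF: "linear_image U K = K" if "U \<in> F" for U using F G(3) that by auto
    have orthF: "orthogonal_matrix U" if "U \<in> F" for U using F Gorth that by auto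
    have Fne: "F \<noteq> {}" using F by auto
    obtain \<nu> where \<nu>: "\<nu> \<in> borel_probs_supported K"
      and mix: "\<And>f. f \<in> borel_measurable borel \<Longrightarrow>
        (\<integral>\<^sup>+x. f x \<partial>\<nu>) = (\<Sum>U\<in>F. \<integral>\<^sup>+x. f (U *v x) \<partial>\<mu>) / ennreal (card F)"
      using exists_orthogonal_mixture[OF F(1) Fne isoF K \<mu>] by metis
    note nu = borel_probs_supportedD[OF \<nu>]
    interpret \<nu>: prob_space \<nu> by (rule nu)
    have en\<nu>: "shifted_log_energy D \<nu> \<le> shifted_log_energy D \<mu>"
      by (rule shifted_log_energy_mixture_le[OF F(1) Fne orthF D0 _ \<mu> \<nu> mix]) (use D in auto)
    have fin\<mu>: "shifted_log_energy D \<mu> < top" using en by (simp add: order_le_less_trans)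
    have fin: "shifted_log_energy D \<nu> < top" using en\<nu> fin\<mu> by (rule order_le_less_trans)
    \<comment> \<open>The push-forward under \<open>U\<close> has weight 1/m in the average, and
      \<open>U\<close> maps the ball about \<open>x\<close> onto the ball about
      \<open>U x\<close>.\<close>
    have mass\<nu>: "p / m \<le> measure \<nu> (cball (U *v x) \<tau>)" if U: "U \<in> F" and x: "x \<in> {a, b}" for U x
    proof -
      let ?S = "cball (U *v x) \<tau>"
      have "ennreal p \<le> emeasure \<mu> (cball x \<tau>)"
        using pab[OF x] by (simp add: \<mu>.emeasure_eq_measure ennreal_leI)
      also have "\<dots> = (\<integral>\<^sup>+y. indicator (cball x \<tau>) y \<partial>\<mu>)" by (simp add: mu(2))
      also have "\<dots> = (\<integral>\<^sup>+y. indicator ?S (U *v y) \<partial>\<mu>)"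
        using norm_orthogonal_matrix_vector[OF orthF[OF U]]
        by (intro nn_integral_cong)
          (simp add: indicator_def dist_norm flip: matrix_vector_mult_diff_distrib)
      also have "\<dots> \<le> (\<Sum>V\<in>F. \<integral>\<^sup>+y. indicator ?S (V *v y) \<partial>\<mu>)"
        using F(1) U by (intro member_le_sum) auto
      finally have "ennreal p / ennreal m \<le> (\<Sum>V\<in>F. \<integral>\<^sup>+y. indicator ?S (V *v y) \<partial>\<mu>) / ennreal (card F)"
        unfolding m_def by (rule divide_right_mono_ennreal)
      also have "\<dots> = (\<integral>\<^sup>+y. indicator ?S y \<partial>\<nu>)" by (rule mix[symmetric], rule borel_measurable_indicator, simp)
      also have "\<dots> = ennreal (measure \<nu> ?S)" by (simp add: nu(2) \<nu>.emeasure_eq_measure)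
      finally show ?thesis using p m0 by (simp add: divide_ennreal ennreal_le_iff)
    qed
    \<comment> \<open>\<open>W\<close> depends on \<open>\<nu>\<close>, and the pair of balls picked
      next depends on \<open>W\<close>; only the bounds \<open>\<delta>\<close> and p/m are
      uniform.\<close>
    obtain W where W: "W \<in> G" and mean: "- \<eta> < normalized_quadratic_mean \<nu> (transpose W ** L ** W)"
      using linear_functional_on_closed_hull[OF linear_normalized_quadratic_mean[OF nu(1,2)]
          zero_in_closed_hull_of_conjugates[OF G(1,2) L] \<eta>] by auto
    note Worth = Gorth[OF W]
    obtain U V x y where UV: "U \<in> F" "V \<in> F" "x \<in> {a, b}" "y \<in> {a, b}"
      and big: "\<delta> \<le> eigen_defect T (W *v (U *v x - V *v y))"
      using def[OF Worth ab] by blast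
    have uv: "norm (U *v x - V *v y) \<le> D"
      using isoF[OF UV(1)] isoF[OF UV(2)] UV(3,4) ab by (intro D) (auto simp: linear_image_def)
    have near: "\<delta> / 2 \<le> eigen_defect T (W *v (x' - y'))"
      if x': "x' \<in> cball (U *v x) \<tau>" and y': "y' \<in> cball (V *v y) \<tau>" for x' y'
    proof -
      have "(x' - y') - (U *v x - V *v y) = (x' - U *v x) + (V *v y - y')" by simp
      then have "norm ((x' - y') - (U *v x - V *v y)) \<le> norm (x' - U *v x) + norm (V *v y - y')"
        by (simp only: norm_triangle_ineq)
      also have "\<dots> \<le> 2 * \<tau>" using x' y' by (simp add: dist_norm norm_minus_commute)
      finally have close: "norm ((x' - y') - (U *v x - V *v y)) \<le> 2 * \<tau>" .
      then have "norm (x' - y') \<le> D + 2"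
        using uv norm_triangle_ineq2[of "x' - y'" "U *v x - V *v y"] \<tau> by linarith
      then have "dist (eigen_defect T (W *v (x' - y'))) (eigen_defect T (W *v (U *v x - V *v y))) < \<delta> / 2"
        using uv close \<tau> norm_orthogonal_matrix_vector[OF Worth]
        by (intro uc) (auto simp: dist_norm simp flip: matrix_vector_mult_diff_distrib[of W])
      then show ?thesis using big unfolding dist_real_def abs_less_iff by linarith
    qed
    have "\<delta> / 2 * (p / m)\<^sup>2 \<le> (\<integral>xy. eigen_defect T (W *v (fst xy - snd xy)) \<partial>(\<nu> \<Otimes>\<^sub>M \<nu>))"
    proof (rule integral_ge_on_rectangle[OF nu(1), where S="cball (U *v x) \<tau>" and R="cball (V *v y) \<tau>"])
      show "integrable (\<nu> \<Otimes>\<^sub>M \<nu>) (\<lambda>xy. eigen_defect T (W *v (fst xy - snd xy)))"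
        by (rule eigen_defect_integrable[OF \<nu> K _ Worth]) (use D in auto)
    qed (use mass\<nu> UV p m0 \<delta> near nu(2) in \<open>auto simp: eigen_defect_nonneg\<close>)
    then have "2 * \<eta> \<le> c / D ^ 4 * (\<integral>xy. eigen_defect T (W *v (fst xy - snd xy)) \<partial>(\<nu> \<Otimes>\<^sub>M \<nu>))"
    proof -
      have "0 \<le> c / D ^ 4" using c D0 by simp
      moreover have "2 * \<eta> = c / D ^ 4 * (\<delta> / 2 * (p / m)\<^sup>2)" by (simp add: \<eta>_def mult_ac)
      ultimately show ?thesis
        using \<open>\<delta> / 2 * (p / m)\<^sup>2 \<le> _\<close> by (simp only: mult_left_mono)
    qed
    moreover have inv: "invertible M" using det by (auto simp: invertible_det_nz)
    let ?\<nu>' = "distr \<nu> borel ((*v) (M ** W))"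
    note transport = shifted_log_energy_transport[OF \<nu> K fin D0 _ _ Worth G(3)[OF W] inv c lb]
    have "shifted_log_energy D ?\<nu>' < top" by (rule transport(1)) (use D DM in auto)
    moreover have "enn2real (shifted_log_energy D ?\<nu>') \<le> enn2real (shifted_log_energy D \<nu>)
      - normalized_quadratic_mean \<nu> (transpose W ** L ** W)
      - c / D ^ 4 * (\<integral>xy. eigen_defect T (W *v (fst xy - snd xy)) \<partial>(\<nu> \<Otimes>\<^sub>M \<nu>))"
      by (rule transport(2)) (use D DM in auto)
    moreover have "enn2real (shifted_log_energy D \<nu>) \<le> enn2real (shifted_log_energy D \<mu>)"
      using en\<nu> fin\<mu> by (rule enn2real_mono)
    moreover have "?\<nu>' \<in> borel_probs_supported (linear_image M K)"
    proof -
      have "linear_image (M ** W) K = linear_image M (linear_image W K)"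
        by (auto simp: linear_image_def image_image matrix_vector_mul_assoc)
      then show ?thesis using borel_probs_supported_linear_image[OF \<nu> K, of "M ** W"] G(3)[OF W] by simp
    qed
    ultimately show ?thesis using mean by (intro bexI[of _ ?\<nu>']) auto
  qed
  then show thesis using that \<eta> by blast
qed

section \<open>Comparison of energies and capacities\<close>

lemma compact_diameter_bound:
  fixes K :: "'a::real_normed_vector set"
  assumes "compact K"
  obtains D where "\<And>x y. x \<in> K \<Longrightarrow> y \<in> K \<Longrightarrow> norm (x - y) \<le> D"
  using compact_imp_bounded[OF assms] unfolding bounded_two_points dist_norm by blast

lemma compact_linear_image: "compact K \<Longrightarrow> compact (linear_image A K)"
  unfolding linear_image_def by (intro compact_continuous_image continuous_intros)

lemma common_diameter_bound:
  assumes "compact K"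
  obtains D where "D \<ge> 1" "\<And>x y. x \<in> K \<Longrightarrow> y \<in> K \<Longrightarrow> norm (x - y) \<le> D"
    "\<And>x y. x \<in> linear_image M K \<Longrightarrow> y \<in> linear_image M K \<Longrightarrow> norm (x - y) \<le> D"
proof -
  obtain D1 where D1: "\<And>x y. x \<in> K \<Longrightarrow> y \<in> K \<Longrightarrow> norm (x - y) \<le> D1"
    using compact_diameter_bound[OF assms] by metis
  obtain D2 where D2: "\<And>x y. x \<in> linear_image M K \<Longrightarrow> y \<in> linear_image M K \<Longrightarrow> norm (x - y) \<le> D2"
    using compact_diameter_bound[OF compact_linear_image[OF assms]] by metis
  show thesis
    by (rule that[of "max 1 (max D1 D2)"]) (use D1 D2 in \<open>fastforce simp: le_max_iff_disj\<close>)+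
qed

lemma log_energy_not_minf:
  fixes K :: "'a::euclidean_space set"
  assumes "compact K"
  shows "log_energy K \<noteq> -\<infinity>"
proof -
  obtain D0 where D0: "\<And>x y. x \<in> K \<Longrightarrow> y \<in> K \<Longrightarrow> norm (x - y) \<le> D0"
    using compact_diameter_bound[OF assms] by metis
  define D where "D = max 1 D0"
  have D: "D \<ge> 1" "norm (x - y) \<le> D" if "x \<in> K" "y \<in> K" for x y
    using D0[OF that] by (auto simp: D_def)
  have "ereal (- ln D) \<le> enn2ereal e - ereal (ln D)" for e
    by (cases e) (auto simp: enn2ereal_ennreal)
  then have "ereal (- ln D) \<le> log_energy K"
    by (subst log_energy_eq_shifted[OF assms, of D]) (use D in \<open>auto simp: D_def intro!: INF_greatest\<close>)
  then show ?thesis by auto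
qed

text \<open>A measure on \<open>K\<close> whose energy exceeds the infimum by less than the uniform
  gap is transported to one below the infimum, so no minimizer has to be produced.\<close>

lemma log_energy_linear_image_less:
  fixes M :: "real^'n^'n"
  assumes K: "compact K" and irr: "has_irreducible_isometry_group K"
    and fin: "log_energy K \<noteq> \<infinity>" and det: "det M = 1 \<or> det M = -1" and M: "\<not> orthogonal_matrix M"
  shows "log_energy (linear_image M K) < log_energy K"
proof -
  obtain G where G: "orthogonal_matrix_group G" "irreducible_matrix_group G" "\<And>U. U \<in> G \<Longrightarrow> linear_image U K = K"
    using irr unfolding has_irreducible_isometry_group_def isometry_of_def by blast
  obtain D where D: "D \<ge> 1" "\<And>x y. x \<in> K \<Longrightarrow> y \<in> K \<Longrightarrow> norm (x - y) \<le> D"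
    and DM: "\<And>x y. x \<in> linear_image M K \<Longrightarrow> y \<in> linear_image M K \<Longrightarrow> norm (x - y) \<le> D"
    using common_diameter_bound[OF K] by metis
  have eK: "log_energy K = (INF \<nu>\<in>borel_probs_supported K. enn2ereal (shifted_log_energy D \<nu>) - ereal (ln D))"
    by (rule log_energy_eq_shifted[OF K D(1)]) (use D in auto)
  have eMK: "log_energy (linear_image M K) =
      (INF \<nu>\<in>borel_probs_supported (linear_image M K). enn2ereal (shifted_log_energy D \<nu>) - ereal (ln D))"
    by (rule log_energy_eq_shifted[OF compact_linear_image[OF K] D(1)]) (use DM in auto)
  obtain v where v: "log_energy K = ereal v" using fin log_energy_not_minf[OF K] by (cases "log_energy K") auto
  have near: "\<exists>\<mu>\<in>borel_probs_supported K. \<exists>e\<ge>0. shifted_log_energy D \<mu> = ennreal e \<and> e - ln D < v + t"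
    if "t > 0" for t
  proof -
    have "log_energy K < ereal (v + t)" using that v by simp
    then obtain \<mu> where \<mu>: "\<mu> \<in> borel_probs_supported K"
      "enn2ereal (shifted_log_energy D \<mu>) - ereal (ln D) < ereal (v + t)"
      unfolding eK INF_less_iff by blast
    then show ?thesis
      by (cases "shifted_log_energy D \<mu>") (auto simp: enn2ereal_ennreal intro!: bexI[of _ \<mu>])
  qed
  \<comment> \<open>A bound for all measures within 1 of the infimum. The gap \<open>\<eta>\<close>
    is obtained from it first; only then is \<open>\<mu>\<close> taken within
    \<open>min 1 \<eta>\<close>.\<close>
  define B where "B = v + 1 + ln D"
  obtain \<mu>1 e1 where "e1 \<ge> 0" "e1 - ln D < v + 1" using near[of 1] by auto
  then have B: "B \<ge> 0" by (simp add: B_def)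
  obtain \<eta> where \<eta>: "\<eta> > 0"
    and gap: "\<And>\<mu>. \<mu> \<in> borel_probs_supported K \<Longrightarrow> shifted_log_energy D \<mu> \<le> ennreal B \<Longrightarrow>
      \<exists>\<nu>\<in>borel_probs_supported (linear_image M K). shifted_log_energy D \<nu> < top \<and>
        enn2real (shifted_log_energy D \<nu>) + \<eta> \<le> enn2real (shifted_log_energy D \<mu>)"
    using uniform_energy_gap[OF G det M K B D DM] by metis
  obtain \<mu> e where \<mu>: "\<mu> \<in> borel_probs_supported K" "e \<ge> 0" "shifted_log_energy D \<mu> = ennreal e"
    and e: "e - ln D < v + min 1 \<eta>"
    using near[of "min 1 \<eta>"] \<eta> by auto
  have "shifted_log_energy D \<mu> \<le> ennreal B" using e \<mu> by (simp add: B_def ennreal_leI)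
  then obtain \<nu> where \<nu>: "\<nu> \<in> borel_probs_supported (linear_image M K)" "shifted_log_energy D \<nu> < top"
    "enn2real (shifted_log_energy D \<nu>) + \<eta> \<le> e"
    using gap[OF \<mu>(1)] \<mu> by auto
  then obtain f where f: "f \<ge> 0" "shifted_log_energy D \<nu> = ennreal f" by (cases "shifted_log_energy D \<nu>") auto
  have "log_energy (linear_image M K) \<le> enn2ereal (shifted_log_energy D \<nu>) - ereal (ln D)"
    unfolding eMK using \<nu>(1) by (rule INF_lower)
  also have "\<dots> < ereal v" using f \<nu>(3) e by (simp add: enn2ereal_ennreal)
  finally show ?thesis by (simp add: v)
qed

lemma log_energy_orthogonal_image_le:
  fixes M :: "real^'n^'n"
  assumes K: "compact K" and M: "orthogonal_matrix M"
  shows "log_energy (linear_image M K) \<le> log_energy K"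
proof -
  obtain D where D: "D \<ge> 1" "\<And>x y. x \<in> K \<Longrightarrow> y \<in> K \<Longrightarrow> norm (x - y) \<le> D"
    and DM: "\<And>x y. x \<in> linear_image M K \<Longrightarrow> y \<in> linear_image M K \<Longrightarrow> norm (x - y) \<le> D"
    using common_diameter_bound[OF K] by metis
  have eK: "log_energy K = (INF \<nu>\<in>borel_probs_supported K. enn2ereal (shifted_log_energy D \<nu>) - ereal (ln D))"
    by (rule log_energy_eq_shifted[OF K D(1)]) (use D in auto)
  have eMK: "log_energy (linear_image M K) =
      (INF \<nu>\<in>borel_probs_supported (linear_image M K). enn2ereal (shifted_log_energy D \<nu>) - ereal (ln D))"
    by (rule log_energy_eq_shifted[OF compact_linear_image[OF K] D(1)]) (use DM in auto)
  have kernel: "shifted_log_kernel D (M *v z) = shifted_log_kernel D z" for z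
  proof -
    have "M *v z = 0 \<longleftrightarrow> z = 0" using norm_orthogonal_matrix_vector[OF M, of z] by (metis norm_eq_zero)
    then show ?thesis by (simp add: shifted_log_kernel_def norm_orthogonal_matrix_vector[OF M])
  qed
  show ?thesis
    unfolding eK eMK
  proof (rule INF_mono)
    fix \<nu> assume \<nu>: "\<nu> \<in> borel_probs_supported K"
    have "shifted_log_energy D (distr \<nu> borel ((*v) M)) = shifted_log_energy D \<nu>"
      unfolding shifted_log_energy_distr[OF borel_probs_supportedD(1,2)[OF \<nu>]] kernel
      by (simp add: shifted_log_energy_def)
    then show "\<exists>\<mu>\<in>borel_probs_supported (linear_image M K).
        enn2ereal (shifted_log_energy D \<mu>) - ereal (ln D) \<le> enn2ereal (shifted_log_energy D \<nu>) - ereal (ln D)"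
      using borel_probs_supported_linear_image[OF \<nu> K] by (intro bexI[of _ "distr \<nu> borel ((*v) M)"]) auto
  qed
qed

lemma log_energy_orthogonal_image:
  fixes M :: "real^'n^'n"
  assumes K: "compact K" and M: "orthogonal_matrix M"
  shows "log_energy (linear_image M K) = log_energy K"
proof (rule antisym[OF log_energy_orthogonal_image_le[OF K M]])
  have "transpose M ** M = mat 1" using M by (simp add: orthogonal_matrix)
  then have "linear_image (transpose M) (linear_image M K) = K"
    unfolding linear_image_def image_image matrix_vector_mul_assoc by simp
  then show "log_energy K \<le> log_energy (linear_image M K)"
    using log_energy_orthogonal_image_le[OF compact_linear_image[OF K], of "transpose M" M] M by simp
qed

lemma log_capacity_less:
  fixes K L :: "'a::euclidean_space set"
  assumes "compact K" "compact L" "log_energy L < log_energy K"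
  shows "log_capacity K < log_capacity L"
  using assms log_energy_not_minf[OF assms(1)] log_energy_not_minf[OF assms(2)]
  by (cases "log_energy K"; cases "log_energy L") (auto simp: log_capacity_def)

lemma log_capacity_linear_image:
  fixes K :: "(real^'n) set" and M :: "real^'n^'n"
  assumes K: "compact K" and irr: "has_irreducible_isometry_group K"
    and pos: "log_capacity K > 0" and det: "det M = 1 \<or> det M = -1"
  shows "log_capacity (linear_image M K) \<ge> log_capacity K"
    and "log_capacity (linear_image M K) = log_capacity K \<longleftrightarrow> orthogonal_matrix M"
proof -
  have fin: "log_energy K \<noteq> \<infinity>" using pos by (auto simp: log_capacity_def)
  have eq: "log_capacity (linear_image M K) = log_capacity K" if "orthogonal_matrix M"
    using log_energy_orthogonal_image[OF K that] by (simp add: log_capacity_def)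
  have less: "log_capacity K < log_capacity (linear_image M K)" if "\<not> orthogonal_matrix M"
    using log_energy_linear_image_less[OF K irr fin det that]
    by (rule log_capacity_less[OF K compact_linear_image[OF K]])
  show "log_capacity (linear_image M K) \<ge> log_capacity K"
    using eq less by (cases "orthogonal_matrix M") auto
  show "log_capacity (linear_image M K) = log_capacity K \<longleftrightarrow> orthogonal_matrix M"
    using eq less by fastforce
qed

section \<open>Volumes of linear images\<close>

text \<open>The library determines the volume of linear images only for wellordered index types, so that result
  is carried over to an arbitrary finite index type through a wellordered copy of it.\<close>

typedef ('a::finite) ordered_index = "{..<CARD('a)}"
  by (auto intro!: exI[of _ 0])

instance ordered_index :: (finite) finite
proof
  show "finite (UNIV :: 'a ordered_index set)"
    unfolding type_definition.univ[OF type_definition_ordered_index] by simp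
qed

instantiation ordered_index :: (finite) wellorder
begin

definition "i \<le> j \<longleftrightarrow> Rep_ordered_index i \<le> Rep_ordered_index j"
definition "i < j \<longleftrightarrow> Rep_ordered_index i < Rep_ordered_index j"

instance
proof
  fix P :: "'a ordered_index \<Rightarrow> bool" and a :: "'a ordered_index"
  assume step: "\<And>x. (\<And>y. y < x \<Longrightarrow> P y) \<Longrightarrow> P x"
  show "P a"
  proof (induction a rule: measure_induct_rule[of Rep_ordered_index])
    case (less x)
    show ?case by (rule step, rule less) (simp add: less_ordered_index_def)
  qed
qed (auto simp: less_eq_ordered_index_def less_ordered_index_def Rep_ordered_index_inject)

end

lemma exists_bij_ordered_index: "\<exists>\<rho> :: 'a::finite ordered_index \<Rightarrow> 'a. bij \<rho>"
proof -
  have "card (UNIV :: 'a ordered_index set) = CARD('a)"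
    using type_definition.card[OF type_definition_ordered_index] by simp
  then show ?thesis using finite_same_card_bij[of "UNIV :: 'a ordered_index set" "UNIV :: 'a set"] by auto
qed

definition reindex_vec :: "('m \<Rightarrow> 'n) \<Rightarrow> real^'n \<Rightarrow> real^'m" where
  "reindex_vec \<rho> x = (\<chi> i. x $ \<rho> i)"

definition reindex_matrix :: "('m \<Rightarrow> 'n) \<Rightarrow> real^'n^'n \<Rightarrow> real^'m^'m" where
  "reindex_matrix \<rho> A = (\<chi> i j. A $ \<rho> i $ \<rho> j)"

lemma prod_Basis_vec: "(\<Prod>b\<in>Basis. v \<bullet> b) = (\<Prod>i\<in>UNIV. v $ i)" for v :: "real^'k"
proof -
  have B: "(Basis :: (real^'k) set) = range (\<lambda>i. axis i 1)" by (auto simp: Basis_vec_def)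
  have inj: "inj (\<lambda>i :: 'k. axis i (1 :: real))" by (auto intro!: injI simp: axis_eq_axis)
  show ?thesis
    unfolding B prod.reindex[OF inj] by (simp add: cart_eq_inner_axis)
qed

context
  fixes \<rho> :: "'m::finite \<Rightarrow> 'n::finite"
  assumes \<rho>: "bij \<rho>"
begin

lemma sum_reindex: "(\<Sum>i\<in>UNIV. f (\<rho> i)) = (\<Sum>j\<in>UNIV. f j :: real)"
  using sum.reindex_bij_betw[of \<rho> UNIV UNIV f] \<rho> by simp

lemma reindex_matrix_vector: "reindex_vec \<rho> (A *v x) = reindex_matrix \<rho> A *v reindex_vec \<rho> x"
  using sum_reindex[of "\<lambda>j. A $ \<rho> _ $ j * x $ j"]
  by (simp add: vec_eq_iff reindex_vec_def reindex_matrix_def matrix_vector_mult_def)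

lemma reindex_matrix_mult: "reindex_matrix \<rho> (A ** B) = reindex_matrix \<rho> A ** reindex_matrix \<rho> B"
  using sum_reindex[of "\<lambda>j. A $ \<rho> _ $ j * B $ j $ \<rho> _"]
  by (simp add: vec_eq_iff reindex_matrix_def matrix_matrix_mult_def)

lemma reindex_matrix_transpose: "reindex_matrix \<rho> (transpose A) = transpose (reindex_matrix \<rho> A)"
  by (simp add: vec_eq_iff reindex_matrix_def transpose_def)

lemma reindex_diag_matrix: "reindex_matrix \<rho> (diag_matrix d) = diag_matrix (d \<circ> \<rho>)"
  using \<rho> by (simp add: vec_eq_iff reindex_matrix_def diag_matrix_def bij_def inj_eq)

lemma reindex_mat_1: "reindex_matrix \<rho> (mat 1) = mat 1"
  using \<rho> by (simp add: vec_eq_iff reindex_matrix_def mat_def bij_def inj_eq)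

text \<open>The square of the determinant is the product of the eigenvalues of the Gram matrix
  \<open>A\<^sup>T A\<close>, and reindexing merely permutes these. Volumes involve only the
  absolute value.\<close>

lemma abs_det_reindex_matrix: "\<bar>det (reindex_matrix \<rho> A)\<bar> = \<bar>det A\<bar>"
proof -
  have det_diag: "det (diag_matrix f) = (\<Prod>i\<in>UNIV. f i)" for f :: "'k::finite \<Rightarrow> real"
    by (subst det_diagonal) (auto simp: diag_matrix_def)
  have sq: "(det B)\<^sup>2 = (\<Prod>i\<in>UNIV. d i)"
    if P: "orthogonal_matrix P" and B: "transpose B ** B = P ** diag_matrix d ** transpose P"
    for B P :: "real^'k^'k" and d
  proof -
    have "(det P)\<^sup>2 = 1" using det_orthogonal_matrix[OF P] by auto
    then show ?thesis
      using arg_cong[OF B, of det] by (simp add: det_mul det_transpose det_diag power2_eq_square mult_ac)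
  qed
  have "transpose (transpose A ** A) = transpose A ** A" by (simp add: matrix_transpose_mul)
  then obtain P d where P: "orthogonal_matrix P" and A: "transpose A ** A = P ** diag_matrix d ** transpose P"
    by (rule symmetric_matrix_diagonalization)
  let ?r = "reindex_matrix \<rho>"
  have "orthogonal_matrix (?r P)"
  proof -
    have "?r (transpose P ** P) = ?r (mat 1)" using P by (simp add: orthogonal_matrix)
    then show ?thesis
      by (simp only: orthogonal_matrix reindex_matrix_mult reindex_matrix_transpose reindex_mat_1)
  qed
  moreover have "transpose (?r A) ** ?r A = ?r P ** diag_matrix (d \<circ> \<rho>) ** transpose (?r P)"
    using arg_cong[OF A, of ?r]
    by (simp add: reindex_matrix_mult reindex_matrix_transpose reindex_diag_matrix)
  ultimately have "(det (?r A))\<^sup>2 = (\<Prod>i\<in>UNIV. (d \<circ> \<rho>) i)" by (rule sq)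
  also have "\<dots> = (\<Prod>j\<in>UNIV. d j)" using prod.reindex_bij_betw[of \<rho> UNIV UNIV d] \<rho> by simp
  also have "\<dots> = (det A)\<^sup>2" using sq[OF P A] by simp
  finally show ?thesis by (simp add: power2_eq_iff abs_eq_iff)
qed

lemma reindex_vec_measurable [measurable]: "reindex_vec \<rho> \<in> borel_measurable borel"
  unfolding reindex_vec_def by (intro borel_measurable_continuous_onI continuous_intros)

text \<open>Lebesgue measure is determined by its values on boxes, and relabelling coordinates pulls
  a box back to a box with permuted side lengths.\<close>

lemma distr_lborel_reindex_vec: "distr lborel borel (reindex_vec \<rho>) = lborel"
proof (rule lborel_eqI[symmetric])
  fix l u :: "real^'m" assume lu: "\<And>b. b \<in> Basis \<Longrightarrow> l \<bullet> b \<le> u \<bullet> b"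
  have "l $ i \<le> u $ i" for i using lu[of "axis i 1"] by (simp add: inner_axis)
  note lu = this
  let ?g = "\<lambda>v :: real^'m. (\<chi> j. v $ inv \<rho> j) :: real^'n"
  have inv: "inv \<rho> (\<rho> i) = i" "\<rho> (inv \<rho> j) = j" for i j
    using \<rho> by (simp_all add: bij_def surj_f_inv_f)
  have "reindex_vec \<rho> -` box l u = box (?g l) (?g u)"
    by (auto simp: mem_box_cart reindex_vec_def) (metis inv)+
  then have "emeasure (distr lborel borel (reindex_vec \<rho>)) (box l u) = emeasure lborel (box (?g l) (?g u))"
    by (subst emeasure_distr) auto
  also have "\<dots> = ennreal (\<Prod>b\<in>Basis. (?g u - ?g l) \<bullet> b)"
    using lu by (intro emeasure_lborel_box) (auto simp: Basis_vec_def inner_axis)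
  also have "(\<Prod>b\<in>Basis. (?g u - ?g l) \<bullet> b) = (\<Prod>j\<in>UNIV. u $ inv \<rho> j - l $ inv \<rho> j)"
    by (simp add: prod_Basis_vec)
  also have "\<dots> = (\<Prod>i\<in>UNIV. u $ i - l $ i)"
    using prod.reindex_bij_betw[of "inv \<rho>" UNIV UNIV "\<lambda>i. u $ i - l $ i"] bij_imp_bij_inv[OF \<rho>] by simp
  also have "\<dots> = (\<Prod>b\<in>Basis. (u - l) \<bullet> b)" by (simp add: prod_Basis_vec)
  finally show "emeasure (distr lborel borel (reindex_vec \<rho>)) (box l u) = ennreal (\<Prod>b\<in>Basis. (u - l) \<bullet> b)" .
qed simp

lemma measure_reindex_vec_image:
  assumes "compact S"
  shows "measure lborel (reindex_vec \<rho> ` S) = measure lborel S"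
proof -
  have "compact (reindex_vec \<rho> ` S)"
    unfolding reindex_vec_def using assms by (intro compact_continuous_image continuous_intros)
  then have "measure lborel (reindex_vec \<rho> ` S) = measure (distr lborel borel (reindex_vec \<rho>)) (reindex_vec \<rho> ` S)"
    by (simp add: distr_lborel_reindex_vec)
  also have "\<dots> = measure lborel (reindex_vec \<rho> -` reindex_vec \<rho> ` S)"
    using \<open>compact (reindex_vec \<rho> ` S)\<close> by (subst measure_distr) (auto simp: compact_imp_closed)
  also have "reindex_vec \<rho> -` reindex_vec \<rho> ` S = S"
  proof (rule inj_vimage_image_eq, rule injI)
    fix x y :: "real^'n" assume "reindex_vec \<rho> x = reindex_vec \<rho> y"
    then have "x $ \<rho> i = y $ \<rho> i" for i by (simp add: reindex_vec_def vec_eq_iff)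
    then show "x = y" using \<rho> by (metis bij_pointE vec_eq_iff)
  qed
  finally show ?thesis .
qed

end

lemma measure_compact_linear_image:
  fixes K :: "(real^'n) set" and A :: "real^'n^'n"
  assumes K: "compact K"
  shows "measure lborel ((*v) A ` K) = \<bar>det A\<bar> * measure lborel K"
proof -
  obtain \<rho> :: "'n ordered_index \<Rightarrow> 'n" where \<rho>: "bij \<rho>" using exists_bij_ordered_index by blast
  let ?h = "reindex_vec \<rho>" and ?A = "reindex_matrix \<rho> A"
  have hK: "compact (?h ` K)"
    unfolding reindex_vec_def using K by (intro compact_continuous_image continuous_intros)
  have AhK: "compact ((*v) ?A ` ?h ` K)" by (intro compact_continuous_image[OF _ hK] continuous_intros)
  have "measure lborel ((*v) A ` K) = measure lborel (?h ` (*v) A ` K)"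
    using K by (intro measure_reindex_vec_image[OF \<rho>, symmetric] compact_continuous_image continuous_intros)
  also have "?h ` (*v) A ` K = (*v) ?A ` ?h ` K"
    by (simp add: image_image reindex_matrix_vector[OF \<rho>])
  also have "measure lborel \<dots> = measure lebesgue ((*v) ?A ` ?h ` K)"
    using AhK by (simp add: compact_imp_closed measure_completion)
  also have "\<dots> = \<bar>det ?A\<bar> * measure lebesgue (?h ` K)"
    using measure_linear_image[OF _ lmeasurable_compact[OF hK], of "(*v) ?A"] by simp
  also have "\<dots> = \<bar>det A\<bar> * measure lborel (?h ` K)"
    using hK by (simp add: compact_imp_closed measure_completion abs_det_reindex_matrix[OF \<rho>])
  finally show ?thesis by (simp add: measure_reindex_vec_image[OF \<rho> K])
qed

lemma det_of_volume_preserving: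
  fixes K :: "(real^'n) set" and A :: "real^'n^'n"
  assumes "compact K" "measure lborel K > 0" "measure lborel (linear_image A K) = measure lborel K"
  shows "det A = 1 \<or> det A = -1"
  using assms measure_compact_linear_image[OF assms(1), of A]
  by (auto simp: linear_image_def abs_if split: if_splits)

theorem theorem1p1:
  fixes K :: "(real^'n) set"
  assumes "CARD('n) \<ge> 2"
    and "compact K"
    and "has_irreducible_isometry_group K"
  shows "(log_capacity K > 0 \<longrightarrow>
           (\<forall>M :: real^'n^'n. det M = 1 \<or> det M = -1 \<longrightarrow>
              log_capacity (linear_image M K) \<ge> log_capacity K \<and>
              (log_capacity (linear_image M K) = log_capacity K \<longleftrightarrow> orthogonal_matrix M)))
       \<and> (measure lborel K > 0 \<longrightarrow>
           (\<forall>A :: real^'n^'n. measure lborel (linear_image A K) = measure lborel K \<longrightarrow>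
              log_capacity K \<le> log_capacity (linear_image A K)))"
proof (intro conjI impI allI)
  fix M :: "real^'n^'n"
  assume "log_capacity K > 0" "det M = 1 \<or> det M = -1"
  then show "log_capacity (linear_image M K) \<ge> log_capacity K"
    and "log_capacity (linear_image M K) = log_capacity K \<longleftrightarrow> orthogonal_matrix M"
    using log_capacity_linear_image[OF assms(2,3)] by blast+
next
  fix A :: "real^'n^'n"
  assume "measure lborel K > 0" "measure lborel (linear_image A K) = measure lborel K"
  then have "det A = 1 \<or> det A = -1" by (rule det_of_volume_preserving[OF assms(2)])
  \<comment> \<open>If \<open>log_capacity K\<close> is 0, the inequality is this nonnegativity; if
    it is positive, the comparison for determinant 1 or -1 applies.\<close>
  moreover have "0 \<le> log_capacity K" "0 \<le> log_capacity (linear_image A K)" by (auto simp: log_capacity_def)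
  ultimately show "log_capacity K \<le> log_capacity (linear_image A K)"
    using log_capacity_linear_image(1)[OF assms(2,3)] by (cases "log_capacity K > 0") auto
qed

end
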